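(* Suppose $\|x^0-x^\star\|_{x^\star}\le\beta$ and the triple $(\sigma,\beta,C)$ satisfies $$\sigma\in(0,1),\quad \beta\in(0,0.5),\quad C>1,\qquad \frac{1}{C(1-\beta)}+\frac{\beta}{(1-2\beta)(1-\beta)^2}\le\sigma,\qquad \frac1C+\frac{1}{1-2\beta}\le 2.$$ Let $\eta_k:=\frac{\beta\sigma^k}{C}$ and let $\{x^k\}$ be updated by the full-step scheme described in the context. Then, for all $k\ge0$, $$\|x^k-x^\star\|_{x^\star}\le\beta\sigma^k\qquad\text{and}\qquad \|x^{k+1}-x^k\|_{x^k}\le2\beta\sigma^k.$$
   Context: Problem. Let $f:\mathbb{R}^p\to\mathbb{R}\cup\{+\infty\}$ be a proper, closed, convex function, three times continuously differentiable on its domain $\mathrm{dom}(f)$, and standard self-concordant: for all $x\in\mathrm{dom}(f)$, $v\in\mathbb{R}^p$, the function $\varphi(\tau):=f(x+\tau v)$ satisfies $|\varphi'''(\tau)|\le 2\varphi''(\tau)^{3/2}$ for all $\tau\in\mathrm{dom}(\varphi)$. The Hessian $\nabla^2 f(x)$ is nondegenerate (hence positive definite) for every $x\in\mathrm{dom}(f)$. Let $\mathcal{X}\subset\mathbb{R}^p$ be nonempty, compact and convex. The problem $f^\star=\min_{x\in\mathcal{X}}f(x)$ has a (necessarily unique) solution $x^\star$. Notation: $\|u\|_x := (u^\top\nabla^2 f(x)u)^{1/2}$. Subroutine $\mathbf{FW}(q,H,u^0,\eta)$ ($q,u^0\in\mathbb{R}^p$, $H$ a symmetric positive definite matrix, $\eta>0$):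 for $t=0,1,\dots$: set $g^t:=q+H(u^t-u^0)$; choose $v^t\in\arg\max_{s\in\mathcal{X}}\langle g^t,u^t-s\rangle$; set $V_t:=\langle g^t,u^t-v^t\rangle$. If $V_t>\eta$, set $\delta_t:=(v^t-u^t)^\top H(v^t-u^t)$, $\tau_t:=\min\{1,V_t/\delta_t\}$, $u^{t+1}:=(1-\tau_t)u^t+\tau_tv^t$; otherwise return $u^t$. Full-step scheme: starting from $x^0\in\mathrm{dom}(f)\cap\mathcal{X}$, for $k=0,1,\dots$ set $z^k:=\mathbf{FW}(\nabla f(x^k),\nabla^2f(x^k),x^k,\eta_k^2)$ and $x^{k+1}:=z^k$. (By the stopping test, $z^k\in\mathcal{X}$ satisfies $\max_{u\in\mathcal{X}}\langle\nabla f(x^k)+\nabla^2f(x^k)(z^k-x^k),z^k-u\rangle\le\eta_k^2$.) *)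

theory Defs
  imports "HOL-Analysis.Analysis"
begin

definition edom :: "('a \<Rightarrow> ereal) \<Rightarrow> 'a set" where
  "edom f = {x. f x < \<infinity>}"

definition epi :: "('a \<Rightarrow> ereal) \<Rightarrow> ('a \<times> real) set" where
  "epi f = {(x, r). f x \<le> ereal r}"

definition proper_closed_convex :: "('a::real_normed_vector \<Rightarrow> ereal) \<Rightarrow> bool" where
  "proper_closed_convex f \<longleftrightarrow>
     (\<forall>x. f x \<noteq> -\<infinity>) \<and> edom f \<noteq> {} \<and> closed (epi f) \<and> convex (epi f)"

text \<open>The finite values of \<open>f\<close>. Its value outside \<open>edom f\<close> is meaningless, but since
  \<open>edom f\<close> is required to be open below, derivatives at points of \<open>edom f\<close> do not depend
  on it.\<close>

definition finval :: "('a \<Rightarrow> ereal) \<Rightarrow> 'a \<Rightarrow> real" where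
  "finval f x = real_of_ereal (f x)"

text \<open>For open \<open>S\<close> in a finite-dimensional space this is the usual class \<open>C\<^sup>k\<close>: all
  iterated directional derivatives up to order \<open>k\<close> exist and those of order \<open>k\<close> are
  continuous.\<close>

primrec cont_diff_on :: "nat \<Rightarrow> 'a::real_normed_vector set \<Rightarrow> ('a \<Rightarrow> real) \<Rightarrow> bool" where
  "cont_diff_on 0 S g \<longleftrightarrow> continuous_on S g"
| "cont_diff_on (Suc k) S g \<longleftrightarrow>
     (\<forall>x\<in>S. g differentiable (at x)) \<and>
     (\<forall>v. cont_diff_on k S (\<lambda>x. frechet_derivative g (at x) v))"

definition partial :: "'n \<Rightarrow> (real ^ 'n \<Rightarrow> real) \<Rightarrow> real ^ 'n \<Rightarrow> real" where
  "partial i g x = frechet_derivative g (at x) (axis i 1)"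

definition grad :: "(real ^ 'n \<Rightarrow> ereal) \<Rightarrow> real ^ 'n \<Rightarrow> real ^ 'n" where
  "grad f x = (\<chi> i. partial i (finval f) x)"

definition hess :: "(real ^ 'n \<Rightarrow> ereal) \<Rightarrow> real ^ 'n \<Rightarrow> real ^ 'n ^ 'n" where
  "hess f x = (\<chi> i j. partial i (partial j (finval f)) x)"

definition local_norm :: "(real ^ 'n \<Rightarrow> ereal) \<Rightarrow> real ^ 'n \<Rightarrow> real ^ 'n \<Rightarrow> real" where
  "local_norm f x u = sqrt (u \<bullet> (hess f x *v u))"

text \<open>Openness of the domain is implicit in the classical differentiability of an
  extended-valued function at every point of its domain.\<close>

definition standard_self_concordant :: "(real ^ 'n \<Rightarrow> ereal) \<Rightarrow> bool" where
  "standard_self_concordant f \<longleftrightarrow>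
     open (edom f) \<and> cont_diff_on 3 (edom f) (finval f) \<and>
     (\<forall>x\<in>edom f. \<forall>v. \<forall>\<tau>. x + \<tau> *\<^sub>R v \<in> edom f \<longrightarrow>
        (let \<phi> = (\<lambda>t::real. finval f (x + t *\<^sub>R v))
         in \<bar>(deriv ^^ 3) \<phi> \<tau>\<bar> \<le> 2 * ((deriv ^^ 2) \<phi> \<tau>) powr (3/2)))"

text \<open>The subroutine is nondeterministic in the choice of the maximizers \<open>v\<close>, so it is
  rendered as a relation: \<open>fw_returns X q H u0 \<eta> z\<close> says that some admissible run
  stops, at iteration \<open>T\<close>, and returns \<open>z\<close>.\<close>

definition fw_grad ::
    "real ^ 'n \<Rightarrow> real ^ 'n ^ 'n \<Rightarrow> real ^ 'n \<Rightarrow> real ^ 'n \<Rightarrow> real ^ 'n" where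
  "fw_grad q H u0 u = q + H *v (u - u0)"

definition fw_gap ::
    "real ^ 'n \<Rightarrow> real ^ 'n ^ 'n \<Rightarrow> real ^ 'n \<Rightarrow> real ^ 'n \<Rightarrow> real ^ 'n \<Rightarrow> real" where
  "fw_gap q H u0 u v = fw_grad q H u0 u \<bullet> (u - v)"

definition fw_update ::
    "real ^ 'n \<Rightarrow> real ^ 'n ^ 'n \<Rightarrow> real ^ 'n \<Rightarrow> real ^ 'n \<Rightarrow> real ^ 'n \<Rightarrow> real ^ 'n" where
  "fw_update q H u0 u v =
     (let \<delta> = (v - u) \<bullet> (H *v (v - u));
          \<tau> = min 1 (fw_gap q H u0 u v / \<delta>)
      in (1 - \<tau>) *\<^sub>R u + \<tau> *\<^sub>R v)"

definition fw_returns ::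
    "(real ^ 'n) set \<Rightarrow> real ^ 'n \<Rightarrow> real ^ 'n ^ 'n \<Rightarrow> real ^ 'n \<Rightarrow> real \<Rightarrow> real ^ 'n \<Rightarrow> bool" where
  "fw_returns X q H u0 \<eta> z \<longleftrightarrow>
     (\<exists>(u :: nat \<Rightarrow> real ^ 'n) (v :: nat \<Rightarrow> real ^ 'n) T.
        u 0 = u0 \<and>
        (\<forall>t\<le>T. is_arg_max (\<lambda>s. fw_grad q H u0 (u t) \<bullet> (u t - s)) (\<lambda>s. s \<in> X) (v t)) \<and>
        (\<forall>t<T. fw_gap q H u0 (u t) (v t) > \<eta> \<and> u (Suc t) = fw_update q H u0 (u t) (v t)) \<and>
        fw_gap q H u0 (u T) (v T) \<le> \<eta> \<and>
        z = u T)"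

definition full_step_scheme ::
    "(real ^ 'n \<Rightarrow> ereal) \<Rightarrow> (real ^ 'n) set \<Rightarrow> (nat \<Rightarrow> real) \<Rightarrow> (nat \<Rightarrow> real ^ 'n) \<Rightarrow> bool" where
  "full_step_scheme f X \<eta> x \<longleftrightarrow>
     x 0 \<in> edom f \<inter> X \<and>
     (\<forall>k. fw_returns X (grad f (x k)) (hess f (x k)) (x k) ((\<eta> k)\<^sup>2) (x (Suc k)))"

end

theory Submission
  imports Defs
begin

text \<open>Put \<open>w = x\<^sup>k\<^sup>+\<^sup>1 - x\<^sup>\<star>\<close> and \<open>\<lambda> = \<parallel>x\<^sup>k - x\<^sup>\<star>\<parallel>\<close> in the local norm at \<open>x\<^sup>\<star>\<close>. Adding the stopping test of
  the subroutine at \<open>x\<^sup>\<star>\<close> to the optimality condition at \<open>x\<^sup>\<star>\<close> bounds the squared local norm of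
  \<open>w\<close> at \<open>x\<^sup>k\<close> by \<open>\<eta>\<^sub>k\<^sup>2\<close> plus the pairing of \<open>w\<close> with the error of the linearised gradient. With
  \<open>r = \<parallel>x\<^sup>\<star> - x\<^sup>k\<parallel>\<close> in the local norm at \<open>x\<^sup>k\<close>, self-concordance bounds the dual norm of that error by
  \<open>r\<^sup>2 / (1 - r)\<close>, and \<open>r \<le> \<lambda> / (1 - \<lambda>)\<close>. Hence the norm of \<open>w\<close> at \<open>x\<^sup>k\<close> is at most
  \<open>\<eta>\<^sub>k + \<lambda>\<^sup>2 / ((1 - \<lambda>) (1 - 2\<lambda>))\<close>; passing to the norm at \<open>x\<^sup>\<star>\<close> costs a factor \<open>1 / (1 - \<lambda>)\<close>.
  The new iterate lies in the Dikin ellipsoid of \<open>x\<^sup>\<star>\<close> and therefore in the domain.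

  Self-concordance controls only the diagonal values \<open>D\<^sup>3f[v,v,v]\<close>. The bound
  \<open>|D\<^sup>3f[u,v,v]| \<le> 2 \<parallel>u\<parallel> \<parallel>v\<parallel>\<^sup>2\<close> follows from an explicit three-point formula that writes the mixed
  value of a symmetric trilinear form as a convex combination of diagonal values.\<close>

subsection \<open>Directional derivatives\<close>

text \<open>The point comes last so that the operator iterates: \<open>dird (dird g u) v\<close>
  differentiates first along \<open>u\<close>, then along \<open>v\<close>.\<close>

definition dird :: "('a::real_normed_vector \<Rightarrow> real) \<Rightarrow> 'a \<Rightarrow> 'a \<Rightarrow> real" where
  "dird g v x = frechet_derivative g (at x) v"

lemma linear_dird: "g differentiable (at x) \<Longrightarrow> linear (\<lambda>v. dird g v x)"
  unfolding dird_def using linear_frechet_derivative by (metis (no_types, lifting) ext)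

lemma dird_line:
  assumes "g differentiable (at (x + t *\<^sub>R v))"
  shows "((\<lambda>s. g (x + s *\<^sub>R v)) has_real_derivative dird g v (x + t *\<^sub>R v)) (at t)"
proof -
  let ?D = "frechet_derivative g (at (x + t *\<^sub>R v))"
  have D: "(g has_derivative ?D) (at (x + t *\<^sub>R v))"
    using assms frechet_derivative_works by blast
  have "((\<lambda>s. x + s *\<^sub>R v) has_derivative (\<lambda>h. h *\<^sub>R v)) (at t)"
    by (auto intro!: derivative_eq_intros)
  from has_derivative_compose[OF this D]
  have "((\<lambda>s. g (x + s *\<^sub>R v)) has_derivative (\<lambda>h. ?D (h *\<^sub>R v))) (at t)" .
  moreover have "(\<lambda>h. ?D (h *\<^sub>R v)) = (*) (dird g v (x + t *\<^sub>R v))"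
    using linear_cmul[OF linear_frechet_derivative[OF assms]] by (auto simp: dird_def)
  ultimately show ?thesis by (simp add: has_field_derivative_def)
qed

lemma dird_cong_open:
  assumes "open S" "x \<in> S" "g differentiable (at x)" "\<And>y. y \<in> S \<Longrightarrow> g y = h y"
  shows "dird g v x = dird h v x"
  unfolding dird_def using frechet_derivative_transform_within_open[OF assms(3,1,2,4)] by simp

section \<open>Second differences: symmetry and sign of second derivatives\<close>

text \<open>The mean value theorem is applied twice: along \<open>u\<close> to the difference of
  \<open>g\<close> on two parallel sides, then along \<open>v\<close> to \<open>dird g u\<close>.
  The second difference itself is symmetric in \<open>u\<close> and \<open>v\<close>.\<close>

lemma second_difference_mvt:
  fixes t :: real
  assumes "0 < t"
    and S: "\<And>a b. 0 \<le> a \<Longrightarrow> a \<le> t \<Longrightarrow> 0 \<le> b \<Longrightarrow> b \<le> t \<Longrightarrow> x + a *\<^sub>R u + b *\<^sub>R v \<in> S"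
    and d1: "\<And>y. y \<in> S \<Longrightarrow> g differentiable (at y)"
    and d2: "\<And>y. y \<in> S \<Longrightarrow> dird g u differentiable (at y)"
  obtains a b where "0 \<le> a" "a \<le> t" "0 \<le> b" "b \<le> t"
    "g (x + t *\<^sub>R u + t *\<^sub>R v) - g (x + t *\<^sub>R u) - g (x + t *\<^sub>R v) + g x
       = t\<^sup>2 * dird (dird g u) v (x + a *\<^sub>R u + b *\<^sub>R v)"
proof -
  define \<phi> where "\<phi> s = g ((x + t *\<^sub>R v) + s *\<^sub>R u) - g (x + s *\<^sub>R u)" for s
  define \<phi>' where "\<phi>' s = dird g u ((x + t *\<^sub>R v) + s *\<^sub>R u) - dird g u (x + s *\<^sub>R u)" for s
  have "(\<phi> has_real_derivative \<phi>' s) (at s)" if "0 \<le> s" "s \<le> t" for s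
    unfolding \<phi>_def \<phi>'_def
    using S[OF that, of t] S[OF that, of 0] \<open>0 < t\<close>
    by (intro DERIV_diff dird_line d1) (auto simp: algebra_simps)
  from MVT2[OF \<open>0 < t\<close> this] obtain a where a: "0 < a" "a < t" "\<phi> t - \<phi> 0 = t * \<phi>' a"
    by auto
  define \<psi> where "\<psi> s = dird g u ((x + a *\<^sub>R u) + s *\<^sub>R v)" for s
  have "(\<psi> has_real_derivative dird (dird g u) v ((x + a *\<^sub>R u) + s *\<^sub>R v)) (at s)"
    if "0 \<le> s" "s \<le> t" for s
    unfolding \<psi>_def using S[of a s] a that by (intro dird_line d2) auto
  from MVT2[OF \<open>0 < t\<close> this] obtain b where b: "0 < b" "b < t"
    "\<psi> t - \<psi> 0 = t * dird (dird g u) v ((x + a *\<^sub>R u) + b *\<^sub>R v)"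
    by auto
  have "\<phi>' a = \<psi> t - \<psi> 0"
    by (simp add: \<phi>'_def \<psi>_def algebra_simps)
  then have "\<phi> t - \<phi> 0 = t\<^sup>2 * dird (dird g u) v ((x + a *\<^sub>R u) + b *\<^sub>R v)"
    using a b by (simp add: power2_eq_square)
  then show ?thesis
    using a b by (intro that[of a b]) (auto simp: \<phi>_def algebra_simps)
qed

lemma small_parallelogram:
  fixes u v :: "'a::real_normed_vector"
  assumes "0 < \<delta>"
  obtains t where "0 < t"
    "\<And>a b. 0 \<le> a \<Longrightarrow> a \<le> t \<Longrightarrow> 0 \<le> b \<Longrightarrow> b \<le> t \<Longrightarrow> x + a *\<^sub>R u + b *\<^sub>R v \<in> ball x \<delta>"
proof
  let ?K = "1 + norm u + norm v" and ?t = "\<delta> / (1 + norm u + norm v)"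
  have K: "0 < ?K" by (smt (verit) norm_ge_zero)
  show "0 < ?t" using assms K by simp
  fix a b assume ab: "0 \<le> a" "a \<le> ?t" "0 \<le> b" "b \<le> ?t"
  have "norm (a *\<^sub>R u + b *\<^sub>R v) \<le> a * norm u + b * norm v"
    using ab norm_triangle_ineq[of "a *\<^sub>R u" "b *\<^sub>R v"] by simp
  also have "\<dots> \<le> ?t * norm u + ?t * norm v"
    using ab by (intro add_mono mult_right_mono) auto
  also have "\<dots> < ?t * ?K"
    using \<open>0 < ?t\<close> by (simp only: distrib_left)
  also have "\<dots> = \<delta>" using K by simp
  finally have "dist (x + (a *\<^sub>R u + b *\<^sub>R v)) x < \<delta>" by (simp add: dist_norm)
  then show "x + a *\<^sub>R u + b *\<^sub>R v \<in> ball x \<delta>"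
    by (simp add: dist_commute add.assoc)
qed

text \<open>Schwarz's theorem. Both orders represent the same second difference at points of a small
  parallelogram, so a gap between them at \<open>x\<close> would contradict continuity.\<close>

lemma dird_dird_commute:
  assumes "open S" "x \<in> S"
    and d1: "\<And>y. y \<in> S \<Longrightarrow> g differentiable (at y)"
    and d2: "\<And>w y. y \<in> S \<Longrightarrow> dird g w differentiable (at y)"
    and c: "\<And>w z. continuous_on S (dird (dird g w) z)"
  shows "dird (dird g u) v x = dird (dird g v) u x"
proof (rule ccontr)
  let ?p = "dird (dird g u) v" and ?q = "dird (dird g v) u"
  assume "?p x \<noteq> ?q x"
  then have e: "0 < \<bar>?p x - ?q x\<bar> / 2" by simp
  have "isCont ?p x" "isCont ?q x"
    using c assms(1,2) continuous_on_eq_continuous_at by blast+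
  then obtain \<delta>1 \<delta>2 where
    \<delta>1: "\<delta>1 > 0" "\<And>y. dist y x < \<delta>1 \<Longrightarrow> dist (?p y) (?p x) < \<bar>?p x - ?q x\<bar> / 2" and
    \<delta>2: "\<delta>2 > 0" "\<And>y. dist y x < \<delta>2 \<Longrightarrow> dist (?q y) (?q x) < \<bar>?p x - ?q x\<bar> / 2"
    using e unfolding continuous_at_eps_delta by metis
  obtain \<delta>3 where \<delta>3: "\<delta>3 > 0" "ball x \<delta>3 \<subseteq> S"
    using assms(1,2) open_contains_ball by blast
  define \<delta> where "\<delta> = min \<delta>1 (min \<delta>2 \<delta>3)"
  have "\<delta> > 0" using \<delta>1 \<delta>2 \<delta>3 by (simp add: \<delta>_def)
  obtain t where t: "0 < t"
    "\<And>a b. 0 \<le> a \<Longrightarrow> a \<le> t \<Longrightarrow> 0 \<le> b \<Longrightarrow> b \<le> t \<Longrightarrow> x + a *\<^sub>R u + b *\<^sub>R v \<in> ball x \<delta>"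
    using small_parallelogram[OF \<open>\<delta> > 0\<close>] by metis
  have t': "x + a *\<^sub>R v + b *\<^sub>R u \<in> ball x \<delta>" if "0 \<le> a" "a \<le> t" "0 \<le> b" "b \<le> t" for a b
    using t(2)[OF that(3,4,1,2)] by (simp add: algebra_simps)
  have bS: "ball x \<delta> \<subseteq> S" using \<delta>3 by (auto simp: \<delta>_def)
  obtain a b where 1: "0 \<le> a" "a \<le> t" "0 \<le> b" "b \<le> t"
    "g (x + t *\<^sub>R u + t *\<^sub>R v) - g (x + t *\<^sub>R u) - g (x + t *\<^sub>R v) + g x
       = t\<^sup>2 * ?p (x + a *\<^sub>R u + b *\<^sub>R v)"
    by (rule second_difference_mvt[OF t(1) t(2), of g]) (use bS d1 d2 in auto)
  obtain a' b' where 2: "0 \<le> a'" "a' \<le> t" "0 \<le> b'" "b' \<le> t"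
    "g (x + t *\<^sub>R v + t *\<^sub>R u) - g (x + t *\<^sub>R v) - g (x + t *\<^sub>R u) + g x
       = t\<^sup>2 * ?q (x + a' *\<^sub>R v + b' *\<^sub>R u)"
    by (rule second_difference_mvt[OF t(1) t', of g]) (use bS d1 d2 in auto)
  have "t\<^sup>2 * ?p (x + a *\<^sub>R u + b *\<^sub>R v) = t\<^sup>2 * ?q (x + a' *\<^sub>R v + b' *\<^sub>R u)"
    using 1(5) 2(5) by (simp add: algebra_simps)
  then have eq: "?p (x + a *\<^sub>R u + b *\<^sub>R v) = ?q (x + a' *\<^sub>R v + b' *\<^sub>R u)"
    using t(1) by simp
  have "dist (?p (x + a *\<^sub>R u + b *\<^sub>R v)) (?p x) < \<bar>?p x - ?q x\<bar> / 2"
    using t(2)[OF 1(1-4)] by (intro \<delta>1) (auto simp: \<delta>_def dist_commute)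
  moreover have "dist (?q (x + a' *\<^sub>R v + b' *\<^sub>R u)) (?q x) < \<bar>?p x - ?q x\<bar> / 2"
    using t'[OF 2(1-4)] by (intro \<delta>2) (auto simp: \<delta>_def dist_commute)
  ultimately show False unfolding eq dist_real_def by (smt (verit) field_sum_of_halves)
qed

text \<open>With both directions equal to \<open>v\<close>, the second difference compares
  \<open>g\<close> at a midpoint with the mean of its endpoint values, hence is nonnegative by
  convexity. A negative derivative at \<open>x\<close> would persist nearby.\<close>

lemma convex_on_imp_dird_dird_nonneg:
  assumes "open S" "x \<in> S" "convex_on S g"
    and d1: "\<And>y. y \<in> S \<Longrightarrow> g differentiable (at y)"
    and d2: "\<And>y. y \<in> S \<Longrightarrow> dird g v differentiable (at y)"
    and c: "continuous_on S (dird (dird g v) v)"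
  shows "0 \<le> dird (dird g v) v x"
proof (rule ccontr)
  let ?p = "dird (dird g v) v"
  assume "\<not> 0 \<le> ?p x"
  then have e: "0 < - ?p x" by simp
  have "isCont ?p x"
    using c assms(1,2) continuous_on_eq_continuous_at by blast
  then obtain \<delta>1 where \<delta>1: "\<delta>1 > 0" "\<And>y. dist y x < \<delta>1 \<Longrightarrow> dist (?p y) (?p x) < - ?p x"
    using e unfolding continuous_at_eps_delta by metis
  obtain \<delta>3 where \<delta>3: "\<delta>3 > 0" "ball x \<delta>3 \<subseteq> S"
    using assms(1,2) open_contains_ball by blast
  define \<delta> where "\<delta> = min \<delta>1 \<delta>3"
  have "\<delta> > 0" using \<delta>1 \<delta>3 by (simp add: \<delta>_def)
  obtain t where t: "0 < t"
    "\<And>a b. 0 \<le> a \<Longrightarrow> a \<le> t \<Longrightarrow> 0 \<le> b \<Longrightarrow> b \<le> t \<Longrightarrow> x + a *\<^sub>R v + b *\<^sub>R v \<in> ball x \<delta>"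
    using small_parallelogram[OF \<open>\<delta> > 0\<close>] by metis
  have bS: "ball x \<delta> \<subseteq> S" using \<delta>3 by (auto simp: \<delta>_def)
  obtain a b where 1: "0 \<le> a" "a \<le> t" "0 \<le> b" "b \<le> t"
    "g (x + t *\<^sub>R v + t *\<^sub>R v) - g (x + t *\<^sub>R v) - g (x + t *\<^sub>R v) + g x
       = t\<^sup>2 * ?p (x + a *\<^sub>R v + b *\<^sub>R v)"
    by (rule second_difference_mvt[OF t(1) t(2), of g]) (use bS d1 d2 in auto)
  have "g ((1/2) *\<^sub>R x + (1/2) *\<^sub>R (x + t *\<^sub>R v + t *\<^sub>R v))
      \<le> (1/2) * g x + (1/2) * g (x + t *\<^sub>R v + t *\<^sub>R v)"
    using convex_onD[OF assms(3), of "1/2" x "x + t *\<^sub>R v + t *\<^sub>R v"] t(1) t(2)[of t t] bS assms(2)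
    by (auto simp: algebra_simps)
  moreover have "(1/2) *\<^sub>R x + (1/2) *\<^sub>R (x + t *\<^sub>R v + t *\<^sub>R v) = x + t *\<^sub>R v"
    by (simp add: algebra_simps flip: scaleR_add_left)
  ultimately have "0 \<le> t\<^sup>2 * ?p (x + a *\<^sub>R v + b *\<^sub>R v)"
    using 1(5) by simp
  then have "0 \<le> ?p (x + a *\<^sub>R v + b *\<^sub>R v)" using t(1) by (simp add: zero_le_mult_iff)
  moreover have "dist (?p (x + a *\<^sub>R v + b *\<^sub>R v)) (?p x) < - ?p x"
    using t(2)[OF 1(1-4)] by (intro \<delta>1) (auto simp: \<delta>_def dist_commute)
  ultimately show False unfolding dist_real_def by linarith
qed

subsection \<open>Symmetric trilinear forms\<close>

text \<open>In the plane spanned by \<open>e\<close> and \<open>f\<close>, let \<open>u\<close> make the angle \<open>3a\<close> with \<open>e\<close>. Then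
  \<open>T[u,e,e]\<close> is a convex combination of the diagonal values of \<open>T\<close> at the unit vectors of
  angles \<open>a\<close>, \<open>a \<plusminus> 2\<pi>/3\<close>; the weights are \<open>((1 + 2 cos \<theta>) / 3)\<^sup>2\<close> with
  \<open>\<theta> = 2a\<close>, \<open>2a \<mp> 2\<pi>/3\<close>. Below \<open>c = cos a\<close>, \<open>s = sin a\<close>, \<open>r = \<surd>3\<close>, and both identities
  are made homogeneous in \<open>(c, s)\<close>.\<close>

lemma cubic_quadrature:
  fixes c s r A B C D :: real
  assumes r: "r\<^sup>2 = 3"
  defines "P \<equiv> \<lambda>x y. x ^ 3 * A + 3 * x\<^sup>2 * y * B + 3 * x * y\<^sup>2 * C + y ^ 3 * D"
  shows "(c\<^sup>2 + s\<^sup>2)\<^sup>2 * ((c ^ 3 - 3 * c * s\<^sup>2) * A + (3 * c\<^sup>2 * s - s ^ 3) * B) =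
      ((3 * c\<^sup>2 - s\<^sup>2) / 3)\<^sup>2 * P c s
    + (2 * s * (s + r * c) / 3)\<^sup>2 * P (- (c + r * s) / 2) (- (s - r * c) / 2)
    + (2 * s * (s - r * c) / 3)\<^sup>2 * P (- (c - r * s) / 2) (- (s + r * c) / 2)"
proof -
  \<comment> \<open>Once powers are expanded into products, these rules remove every pair of factors
    \<open>r\<close>, also inside longer products.\<close>
  have r2: "r * r = 3" "\<And>z. r * (r * z) = 3 * z" using r by (simp_all add: power2_eq_square)
  show ?thesis unfolding P_def
    by (simp add: field_simps power_numeral_reduce r2)
qed

lemma cubic_quadrature_weights:
  fixes c s r :: real
  assumes r: "r\<^sup>2 = 3"
  shows "((3 * c\<^sup>2 - s\<^sup>2) / 3)\<^sup>2 + (2 * s * (s + r * c) / 3)\<^sup>2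
    + (2 * s * (s - r * c) / 3)\<^sup>2 = (c\<^sup>2 + s\<^sup>2)\<^sup>2"
proof -
  have r2: "r * r = 3" "\<And>z. r * (r * z) = 3 * z" using r by (simp_all add: power2_eq_square)
  show ?thesis 
    by (simp add: field_simps power_numeral_reduce r2)
qed


lemma cos_sin_treble:
  fixes a :: real
  shows "cos (3 * a) = cos a ^ 3 - 3 * cos a * (sin a)\<^sup>2"
    and "sin (3 * a) = 3 * (cos a)\<^sup>2 * sin a - sin a ^ 3"
proof -
  have "3 * a = a + (a + a)" by simp
  then show "cos (3 * a) = cos a ^ 3 - 3 * cos a * (sin a)\<^sup>2"
    and "sin (3 * a) = 3 * (cos a)\<^sup>2 * sin a - sin a ^ 3"
    by (simp_all only: cos_add sin_add) (simp_all add: field_simps power_numeral_reduce)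
qed

text \<open>Normalise \<open>v\<close> to \<open>e\<close> and \<open>u\<close> to \<open>u'\<close>
  with respect to \<open>B\<close>, and write \<open>u'\<close> in the plane of \<open>e\<close> and
  an orthogonal \<open>f\<close>. Then \<open>cubic_quadrature\<close> averages three diagonal
  values, each at most \<open>M\<close> in absolute value, with nonnegative weights of sum
  1.\<close>

lemma symmetric_trilinear_le_diagonal:
  fixes T :: "'a::real_vector \<Rightarrow> 'a \<Rightarrow> 'a \<Rightarrow> real" and B :: "'a \<Rightarrow> 'a \<Rightarrow> real"
  assumes linT: "\<And>v w. linear (\<lambda>u. T u v w)"
    and sym12: "\<And>u v w. T u v w = T v u w" and sym23: "\<And>u v w. T u v w = T u w v"
    and linB: "\<And>v. linear (\<lambda>u. B u v)" and symB: "\<And>u v. B u v = B v u"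
    and pos: "\<And>v. v \<noteq> 0 \<Longrightarrow> 0 < B v v"
    and bd: "\<And>v. \<bar>T v v v\<bar> \<le> M * sqrt (B v v) ^ 3"
  shows "\<bar>T u v v\<bar> \<le> M * sqrt (B u u) * B v v"
proof (cases "u = 0 \<or> v = 0")
  case True
  have "T 0 v v = 0" "B 0 0 = 0" "T 0 u 0 = 0"
    by (rule linear_0[OF linT] linear_0[OF linB])+
  with True sym12[of u 0 0] show ?thesis by auto
next
  case False
  have T1: "T (a *\<^sub>R p + b *\<^sub>R q) y z = a * T p y z + b * T q y z" for a b p q y z
    using linear_add[OF linT[of y z], of "a *\<^sub>R p" "b *\<^sub>R q"]
      linear_cmul[OF linT[of y z], of a p] linear_cmul[OF linT[of y z], of b q] by simp
  have T2: "T y (a *\<^sub>R p + b *\<^sub>R q) z = a * T y p z + b * T y q z" for a b p q y z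
    using T1[of a p b q y z] sym12 by metis
  have T3: "T y z (a *\<^sub>R p + b *\<^sub>R q) = a * T y z p + b * T y z q" for a b p q y z
    using T2[of y a p b q z] sym23 by metis
  have B1: "B (a *\<^sub>R p + b *\<^sub>R q) y = a * B p y + b * B q y" for a b p q y
    using linear_add[OF linB[of y], of "a *\<^sub>R p" "b *\<^sub>R q"]
      linear_cmul[OF linB[of y], of a p] linear_cmul[OF linB[of y], of b q] by simp
  have B2: "B y (a *\<^sub>R p + b *\<^sub>R q) = a * B y p + b * B y q" for a b p q y
    using B1[of a p b q y] symB by metis
  have Bnn: "0 \<le> B w w" for w
    using pos[of w] linear_0[OF linB] by (cases "w = 0") auto
  define \<mu> \<nu> where "\<mu> = sqrt (B u u)" and "\<nu> = sqrt (B v v)"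
  have \<mu>\<nu>: "0 < \<mu>" "0 < \<nu>" "\<mu>\<^sup>2 = B u u" "\<nu>\<^sup>2 = B v v"
    using False pos[of u] pos[of v] by (auto simp: \<mu>_def \<nu>_def)
  have Bs: "B (a *\<^sub>R p) (a *\<^sub>R p) = a\<^sup>2 * B p p" for a p
    using B1[of a p 0 p] B2[of _ a p 0 p] by (simp add: power2_eq_square)
  have Ts: "T (a *\<^sub>R p) (b *\<^sub>R q) (b *\<^sub>R q) = a * b\<^sup>2 * T p q q" for a b p q
    using T1[of a p 0 p] T2[of _ b q 0 q] T3[of _ _ b q 0 q] by (simp add: power2_eq_square)
  define e u' where "e = (1/\<nu>) *\<^sub>R v" and "u' = (1/\<mu>) *\<^sub>R u"
  have ee: "B e e = 1"
    unfolding e_def Bs \<mu>\<nu>(4)[symmetric] using \<mu>\<nu>(2) by (simp add: power_divide)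
  have uu: "B u' u' = 1"
    unfolding u'_def Bs \<mu>\<nu>(3)[symmetric] using \<mu>\<nu>(1) by (simp add: power_divide)
  define k where "k = B u' e"
  \<comment> \<open>The component of \<open>u'\<close> orthogonal to \<open>e\<close>, written as a
    linear combination to which \<open>B1\<close> and \<open>B2\<close> apply.\<close>
  define g where "g = 1 *\<^sub>R u' + (- k) *\<^sub>R e"
  have ge: "B e g = 0"
    unfolding g_def B2 k_def using ee symB[of e u'] by simp
  have gg: "B g g = 1 - k\<^sup>2"
    unfolding g_def B2 B1 using ee uu symB[of e u']
    by (simp add: k_def power2_eq_square)
  have k1: "k\<^sup>2 \<le> 1" using Bnn[of g] gg by simp
  then have k: "- 1 \<le> k" "k \<le> 1" by (auto simp: abs_square_le_1 abs_le_iff)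
  \<comment> \<open>A third of the angle between \<open>e\<close> and \<open>u'\<close>.\<close>
  define a where "a = arccos k / 3"
  have cos3: "cos (3 * a) = k" unfolding a_def using k by simp
  have sin3: "(sin (3 * a))\<^sup>2 = 1 - k\<^sup>2" using sin_squared_eq[of "3 * a"] cos3 by simp
  \<comment> \<open>If \<open>u'\<close> and \<open>e\<close> are parallel, then \<open>f = 0\<close>; so only \<open>B f f \<le> 1\<close> is available.\<close>
  define f where "f = (1 / sin (3 * a)) *\<^sub>R g"
  have ef: "B e f = 0" unfolding f_def using ge B2[of e "1 / sin (3 * a)" g 0 g] by simp
  have ff: "B f f \<le> 1"
    unfolding f_def Bs gg sin3[symmetric] by (simp add: power_divide)
  have u': "u' = cos (3 * a) *\<^sub>R e + sin (3 * a) *\<^sub>R f"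
  proof (cases "sin (3 * a) = 0")
    case True
    then have "B g g = 0" using gg sin3 by simp
    then have "g = 0" using pos[of g] by fastforce
    then show ?thesis using True cos3 by (simp add: g_def)
  next
    case False
    then show ?thesis using cos3 by (simp add: f_def g_def)
  qed
  have bnd: "\<bar>T (x *\<^sub>R e + y *\<^sub>R f) (x *\<^sub>R e + y *\<^sub>R f) (x *\<^sub>R e + y *\<^sub>R f)\<bar> \<le> M"
    if "x\<^sup>2 + y\<^sup>2 = 1" for x y
  proof -
    let ?w = "x *\<^sub>R e + y *\<^sub>R f"
    have "M \<ge> 0" using bd[of e] ee by simp
    have "B ?w ?w = x\<^sup>2 + y\<^sup>2 * B f f"
      using ee ef symB[of e f] by (simp add: B1 B2 power2_eq_square algebra_simps)
    also have "\<dots> \<le> x\<^sup>2 + y\<^sup>2 * 1" using ff by (intro add_left_mono mult_left_mono) auto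
    finally have "sqrt (B ?w ?w) ^ 3 \<le> 1"
      using that Bnn[of ?w] by (intro power_le_one) auto
    then show ?thesis
      using bd[of ?w] mult_left_mono[OF _ \<open>M \<ge> 0\<close>, of "sqrt (B ?w ?w) ^ 3" 1] by linarith
  qed
  \<comment> \<open>The cubic form of \<open>T\<close> in the coordinates of the plane spanned by
    \<open>e\<close> and \<open>f\<close>.\<close>
  define P where "P x y = x ^ 3 * T e e e + 3 * x\<^sup>2 * y * T e e f + 3 * x * y\<^sup>2 * T e f f
    + y ^ 3 * T f f f" for x y
  have P: "T (x *\<^sub>R e + y *\<^sub>R f) (x *\<^sub>R e + y *\<^sub>R f) (x *\<^sub>R e + y *\<^sub>R f) = P x y" for x y
  proof -
    have "T f e e = T e e f" "T e f e = T e e f" "T f e f = T e f f" "T f f e = T e f f"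
      using sym12 sym23 by metis+
    then show ?thesis
      unfolding P_def T1 T2 T3 by (simp add: field_simps power_numeral_reduce)
  qed
  define c s r where "c = cos a" and "s = sin a" and "r = sqrt (3::real)"
  have cs: "c\<^sup>2 + s\<^sup>2 = 1" by (simp add: c_def s_def)
  have r: "r\<^sup>2 = 3" by (simp add: r_def)
  have r2: "r * r = 3" "\<And>z. r * (r * z) = 3 * z" using r by (simp_all add: power2_eq_square)
  define w0 w1 w2 where "w0 = ((3 * c\<^sup>2 - s\<^sup>2) / 3)\<^sup>2" and "w1 = (2 * s * (s + r * c) / 3)\<^sup>2"
    and "w2 = (2 * s * (s - r * c) / 3)\<^sup>2"
  have "T u' e e = cos (3 * a) * T e e e + sin (3 * a) * T e e f"
    unfolding u' T1 using sym12 sym23 by metis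
  also have "\<dots> = w0 * P c s
      + w1 * P (- (c + r * s) / 2) (- (s - r * c) / 2)
      + w2 * P (- (c - r * s) / 2) (- (s + r * c) / 2)"
    using cubic_quadrature[OF r, of c s "T e e e" "T e e f" "T e f f" "T f f f"]
    unfolding P_def cos_sin_treble c_def[symmetric] s_def[symmetric] cs w0_def w1_def w2_def by simp
  finally have eq: "T u' e e = w0 * P c s
      + w1 * P (- (c + r * s) / 2) (- (s - r * c) / 2)
      + w2 * P (- (c - r * s) / 2) (- (s + r * c) / 2)" .
  \<comment> \<open>The other two nodes are the rotations of \<open>(c, s)\<close> by plus and minus
    120 degrees, so they lie on the same circle and \<open>bnd\<close> applies.\<close>
  have "(- (c + r * s) / 2)\<^sup>2 + (- (s - r * c) / 2)\<^sup>2 = c\<^sup>2 + s\<^sup>2"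
    "(- (c - r * s) / 2)\<^sup>2 + (- (s + r * c) / 2)\<^sup>2 = c\<^sup>2 + s\<^sup>2"
    by (simp_all add: field_simps power2_eq_square r2)
  then have "\<bar>P c s\<bar> \<le> M" "\<bar>P (- (c + r * s) / 2) (- (s - r * c) / 2)\<bar> \<le> M"
    "\<bar>P (- (c - r * s) / 2) (- (s + r * c) / 2)\<bar> \<le> M"
    using bnd cs by (simp_all only: P)
  moreover have "0 \<le> w0" "0 \<le> w1" "0 \<le> w2" by (simp_all add: w0_def w1_def w2_def)
  ultimately have le: "\<bar>w0 * P c s\<bar> \<le> w0 * M"
    "\<bar>w1 * P (- (c + r * s) / 2) (- (s - r * c) / 2)\<bar> \<le> w1 * M"
    "\<bar>w2 * P (- (c - r * s) / 2) (- (s + r * c) / 2)\<bar> \<le> w2 * M"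
    by (simp_all add: abs_mult mult_left_mono)
  have "w0 + w1 + w2 = 1"
    using cubic_quadrature_weights[OF r, of c s] cs by (simp add: w0_def w1_def w2_def)
  then have "w0 * M + w1 * M + w2 * M = M" by (simp flip: distrib_right)
  then have "\<bar>T u' e e\<bar> \<le> M" using eq le by linarith
  moreover have "T u' e e = T u v v / (\<mu> * \<nu>\<^sup>2)"
    by (simp add: u'_def e_def Ts power_divide)
  ultimately have "\<bar>T u v v\<bar> / (\<mu> * \<nu>\<^sup>2) \<le> M"
    using \<mu>\<nu>(1,2) by (simp add: abs_mult)
  then have "\<bar>T u v v\<bar> \<le> M * (\<mu> * \<nu>\<^sup>2)" using \<mu>\<nu>(1,2) by (simp add: pos_divide_le_eq)
  then show ?thesis using \<mu>\<nu>(4) by (simp add: \<mu>_def mult.assoc)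
qed

subsection \<open>Self-concordant functions\<close>

text \<open>Derivative of the comparison function for the Hessian along a segment whose direction
  has local norm \<open>r\<close>.\<close>

lemma deriv_inverse_square:
  fixes r s :: real
  assumes "1 - s * r \<noteq> 0"
  shows "((\<lambda>s. 1 / (1 - s * r)\<^sup>2) has_real_derivative 2 * r / (1 - s * r) ^ 3) (at s)"
proof -
  have "((\<lambda>s. inverse ((1 - s * r)\<^sup>2)) has_real_derivative
      - (inverse ((1 - s * r)\<^sup>2) * (- (2 * r * (1 - s * r))) * inverse ((1 - s * r)\<^sup>2))) (at s)"
    using assms by (intro DERIV_inverse') (auto intro!: derivative_eq_intros)
  moreover have "- (inverse ((1 - s * r)\<^sup>2) * (- (2 * r * (1 - s * r))) * inverse ((1 - s * r)\<^sup>2))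
      = 2 * r / (1 - s * r) ^ 3"
    using assms by (simp add: divide_inverse power_numeral_reduce)
  ultimately show ?thesis by (simp only: divide_inverse mult_1_left)
qed

text \<open>A coordinate-free setting in terms of iterated directional derivatives. The matrix
  \<open>hess\<close> and the vector \<open>grad\<close> are linked to it by
  \<open>hess_inner\<close> and \<open>grad_inner\<close>.\<close>

locale c3_function =
  fixes S :: "'a::real_normed_vector set" and g :: "'a \<Rightarrow> real"
  assumes open_S: "open S"
    and diff1: "x \<in> S \<Longrightarrow> g differentiable (at x)"
    and diff2: "x \<in> S \<Longrightarrow> dird g u differentiable (at x)"
    and diff3: "x \<in> S \<Longrightarrow> dird (dird g u) v differentiable (at x)"
    and cont3: "continuous_on S (dird (dird (dird g u) v) w)"
begin

definition H :: "'a \<Rightarrow> 'a \<Rightarrow> 'a \<Rightarrow> real" where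
  "H x u v = dird (dird g u) v x"

definition K :: "'a \<Rightarrow> 'a \<Rightarrow> 'a \<Rightarrow> 'a \<Rightarrow> real" where
  "K x u v w = dird (dird (dird g u) v) w x"

definition nrm :: "'a \<Rightarrow> 'a \<Rightarrow> real" where
  "nrm x v = sqrt (H x v v)"

lemma H_commute: "x \<in> S \<Longrightarrow> H x u v = H x v u"
  unfolding H_def
  using open_S diff1 diff2 diff3
  by (intro dird_dird_commute[of S])
    (auto intro!: differentiable_imp_continuous_on differentiable_at_imp_differentiable_on)

lemma K_commute23: "x \<in> S \<Longrightarrow> K x u v w = K x u w v"
  unfolding K_def using open_S diff2 diff3 cont3 by (intro dird_dird_commute[of S]) auto

text \<open>The identity \<open>H_commute\<close> holds on an open set and can therefore be
  differentiated.\<close>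

lemma K_commute12: "x \<in> S \<Longrightarrow> K x u v w = K x v u w"
  unfolding K_def using open_S diff3 H_commute unfolding H_def by (intro dird_cong_open[of S]) auto

lemma linear_H: "x \<in> S \<Longrightarrow> linear (H x u)"
  using linear_dird[OF diff2] unfolding H_def by blast

lemma linear_H_left: "x \<in> S \<Longrightarrow> linear (\<lambda>u. H x u v)"
  using linear_H[of x v] ext[of "\<lambda>u. H x u v" "H x v", OF H_commute] by simp

text \<open>Linearity of a derivative is immediate in the last direction; the symmetries carry it to
  the first.\<close>

lemma linear_K: "x \<in> S \<Longrightarrow> linear (\<lambda>u. K x u v w)"
proof -
  assume x: "x \<in> S"
  have "(\<lambda>u. K x u v w) = (\<lambda>u. K x v w u)"
    using K_commute12[OF x] K_commute23[OF x] by metis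
  then show ?thesis using linear_dird[OF diff3[OF x]] unfolding K_def by simp
qed

end

text \<open>Nondegeneracy says that the second differential has trivial kernel; together with
  convexity this yields positive definiteness in \<open>hess_pos\<close>.\<close>

locale self_concordant = c3_function +
  assumes convex_g: "convex_on S g"
    and nondegenerate: "x \<in> S \<Longrightarrow> v \<noteq> 0 \<Longrightarrow> \<exists>w. H x v w \<noteq> 0"
    and third_le: "x \<in> S \<Longrightarrow> \<bar>K x v v v\<bar> \<le> 2 * H x v v powr (3/2)"
begin

lemma convex_S: "convex S"
  using convex_g by (rule convex_on_imp_convex)

lemma H_nonneg: "x \<in> S \<Longrightarrow> 0 \<le> H x v v"
  unfolding H_def using open_S convex_g diff1 diff2 diff3
  by (intro convex_on_imp_dird_dird_nonneg[of S])
    (auto intro!: differentiable_imp_continuous_on differentiable_at_imp_differentiable_on)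

text \<open>If a nonnegative form vanishes at \<open>v\<close> but pairs \<open>v\<close> with some
  \<open>w\<close> nontrivially, then its value at \<open>t *\<^sub>R v + w\<close> is affine and
  nonconstant in \<open>t\<close>, hence negative somewhere.\<close>

lemma hess_pos:
  assumes x: "x \<in> S" and "v \<noteq> 0"
  shows "0 < H x v v"
proof (rule ccontr)
  assume "\<not> 0 < H x v v"
  then have vv: "H x v v = 0" using H_nonneg[OF x, of v] by simp
  obtain w where w: "H x v w \<noteq> 0" using nondegenerate assms by blast
  note lin = linear_add[OF linear_H[OF x]] linear_cmul[OF linear_H[OF x]]
    linear_add[OF linear_H_left[OF x]] linear_cmul[OF linear_H_left[OF x]]
  \<comment> \<open>Chosen so that the form takes the value -1.\<close>
  define t where "t = - (H x w w + 1) / (2 * H x v w)"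
  have "0 \<le> H x (t *\<^sub>R v + w) (t *\<^sub>R v + w)" by (rule H_nonneg[OF x])
  also have "\<dots> = 2 * t * H x v w + H x w w"
    using vv H_commute[OF x, of w v] unfolding lin by simp
  also have "2 * t * H x v w = - (H x w w + 1)" using w by (simp add: t_def)
  finally show False by simp
qed

lemma nrm_nonneg: "x \<in> S \<Longrightarrow> 0 \<le> nrm x v"
  by (simp add: nrm_def H_nonneg)

lemma nrm_squared: "x \<in> S \<Longrightarrow> (nrm x v)\<^sup>2 = H x v v"
  by (simp add: nrm_def H_nonneg)

lemma nrm_0 [simp]: "x \<in> S \<Longrightarrow> nrm x 0 = 0"
  using linear_0[OF linear_H[of x 0]] by (simp add: nrm_def)

lemma nrm_minus: "x \<in> S \<Longrightarrow> nrm x (- v) = nrm x v"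
  using linear_neg[OF linear_H, of x "- v" v] linear_neg[OF linear_H_left, of x v v]
  by (simp add: nrm_def)

lemma third_diag_le: "x \<in> S \<Longrightarrow> \<bar>K x v v v\<bar> \<le> 2 * nrm x v ^ 3"
proof -
  assume x: "x \<in> S"
  have "H x v v powr (3/2) = nrm x v ^ 3"
  proof (cases "v = 0")
    case True
    then show ?thesis using x linear_0[OF linear_H[OF x, of 0]] by simp
  next
    case False
    then have "0 < H x v v" using hess_pos x by simp
    then have "H x v v powr (3/2) = (H x v v powr (1/2)) powr (real 3)"
      by (simp add: powr_powr)
    also have "\<dots> = nrm x v ^ 3"
      using \<open>0 < H x v v\<close> by (subst powr_realpow) (auto simp: nrm_def powr_half_sqrt)
    finally show ?thesis .
  qed
  then show ?thesis using third_le[OF x, of v] by simp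
qed

text \<open>The trilinear estimate with constant 2. It controls how \<open>H\<close> at a fixed
  \<open>v\<close> varies when the point moves along a different direction \<open>u\<close>.\<close>

lemma third_mixed_le: "x \<in> S \<Longrightarrow> \<bar>K x u v v\<bar> \<le> 2 * nrm x u * H x v v"
  unfolding nrm_def
  by (rule symmetric_trilinear_le_diagonal[where B = "H x" and T = "K x"])
    (use linear_K K_commute12 K_commute23 linear_H_left H_commute hess_pos third_diag_le in
      \<open>auto simp: nrm_def\<close>)

lemma H_CS: "x \<in> S \<Longrightarrow> \<bar>H x u v\<bar> \<le> nrm x u * nrm x v"
proof (cases "v = 0")
  case True
  assume "x \<in> S"
  then show ?thesis using True linear_0[OF linear_H[of x u]] by simp
next
  case False
  assume x: "x \<in> S"
  note lin = linear_add[OF linear_H[OF x]] linear_cmul[OF linear_H[OF x]]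
    linear_add[OF linear_H_left[OF x]] linear_cmul[OF linear_H_left[OF x]]
  let ?a = "H x v v" and ?b = "H x u v"
  have a: "0 < ?a" using False x hess_pos by simp
  \<comment> \<open>The test vector is \<open>H x v v\<close> times the component of
    \<open>u\<close> orthogonal to \<open>v\<close>.\<close>
  have "0 \<le> H x (?a *\<^sub>R u + (- ?b) *\<^sub>R v) (?a *\<^sub>R u + (- ?b) *\<^sub>R v)"
    by (rule H_nonneg[OF x])
  also have "\<dots> = ?a * (H x u u * ?a - ?b\<^sup>2)"
    using H_commute[OF x, of v u] unfolding lin by (simp add: algebra_simps power2_eq_square)
  finally have "?b\<^sup>2 \<le> (nrm x u * nrm x v)\<^sup>2"
    using a by (simp add: zero_le_mult_iff power_mult_distrib nrm_squared[OF x])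
  then show ?thesis
    using nrm_nonneg[OF x] by (simp add: abs_le_square_iff[symmetric])
qed

lemma nrm_triangle: "x \<in> S \<Longrightarrow> nrm x (u + v) \<le> nrm x u + nrm x v"
proof -
  assume x: "x \<in> S"
  note lin = linear_add[OF linear_H[OF x]] linear_add[OF linear_H_left[OF x]]
  have "(nrm x (u + v))\<^sup>2 = (nrm x u)\<^sup>2 + 2 * H x u v + (nrm x v)\<^sup>2"
    unfolding nrm_squared[OF x] lin using H_commute[OF x, of v u] by simp
  also have "\<dots> \<le> (nrm x u + nrm x v)\<^sup>2"
    using H_CS[OF x, of u v] by (simp add: power2_eq_square algebra_simps)
  finally show ?thesis
    using nrm_nonneg[OF x] by (meson add_nonneg_nonneg power2_le_imp_le)
qed

lemma segment_in:
  fixes s t :: real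
  assumes "x \<in> S" "x + t *\<^sub>R d \<in> S" "0 \<le> s" "s \<le> t"
  shows "x + s *\<^sub>R d \<in> S"
proof (cases "t = 0")
  case True
  then show ?thesis using assms by simp
next
  case False
  then have "(1 - s / t) *\<^sub>R x + (s / t) *\<^sub>R (x + t *\<^sub>R d) \<in> S"
    using assms by (intro convexD[OF convex_S]) auto
  then show ?thesis using False by (simp add: algebra_simps)
qed

lemma H_line:
  "x + s *\<^sub>R d \<in> S \<Longrightarrow>
    ((\<lambda>s. H (x + s *\<^sub>R d) u v) has_real_derivative K (x + s *\<^sub>R d) u v d) (at s)"
  unfolding H_def K_def by (intro dird_line diff3)

section \<open>Comparison of local norms along a segment\<close>

lemma nrm_along_le:
  fixes t :: real
  assumes x: "x \<in> S" and xt: "x + t *\<^sub>R d \<in> S" and t: "0 \<le> t" and r: "t * nrm x d < 1"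
  shows "nrm (x + t *\<^sub>R d) d \<le> nrm x d / (1 - t * nrm x d)"
proof (cases "d = 0")
  case True
  then show ?thesis using x by simp
next
  case False
  define h where "h s = H (x + s *\<^sub>R d) d d" for s
  \<comment> \<open>Self-concordance says that \<open>h powr (-1/2)\<close> is 1-Lipschitz.\<close>
  let ?f = "\<lambda>s. inverse (sqrt (h s)) + s"
  have hp: "0 < h s" if "0 \<le> s" "s \<le> t" for s
    using segment_in[OF x xt that] False hess_pos by (simp add: h_def)
  \<comment> \<open>Up to sign, the left side is the derivative of \<open>inverse q\<close> when
    \<open>q\<close> is the square root of a function with derivative \<open>k\<close>.\<close>
  have le1: "inverse q * (inverse q / 2 * k) * inverse q \<le> 1" if "0 < q" "k \<le> 2 * q ^ 3"
    for q k :: real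
    using that by (simp add: field_simps power_numeral_reduce)
  have "?f 0 \<le> ?f t"
  proof (rule DERIV_nonneg_imp_nondecreasing[OF t])
    fix s assume s: "0 \<le> s" "s \<le> t"
    note S = segment_in[OF x xt s]
    let ?q = "sqrt (h s)" and ?k = "K (x + s *\<^sub>R d) d d d"
    have q: "0 < ?q" using hp[OF s] by simp
    have "((\<lambda>s. h s) has_real_derivative ?k) (at s)"
      unfolding h_def by (rule H_line[OF S])
    from DERIV_chain2[OF DERIV_real_sqrt[OF hp[OF s]] this]
    have "((\<lambda>s. sqrt (h s)) has_real_derivative inverse ?q / 2 * ?k) (at s)" .
    then have D: "(?f has_real_derivative
       - (inverse ?q * (inverse ?q / 2 * ?k) * inverse ?q) + 1) (at s)"
      using q by (intro DERIV_add DERIV_inverse' DERIV_ident) auto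
    have "?k \<le> 2 * ?q ^ 3"
      using third_diag_le[OF S, of d] by (simp add: nrm_def h_def)
    then have "inverse ?q * (inverse ?q / 2 * ?k) * inverse ?q \<le> 1"
      using le1[OF q] by blast
    with D show "\<exists>y. (?f has_real_derivative y) (at s) \<and> 0 \<le> y"
      by (intro exI[of _ "- (inverse ?q * (inverse ?q / 2 * ?k) * inverse ?q) + 1"]) auto
  qed
  then have *: "inverse (nrm x d) \<le> inverse (nrm (x + t *\<^sub>R d) d) + t"
    by (simp add: h_def nrm_def)
  have "0 < nrm x d" "0 < nrm (x + t *\<^sub>R d) d"
    using hp[of 0] hp[of t] t by (simp_all add: h_def nrm_def)
  then show ?thesis using * r by (simp add: field_simps)
qed

text \<open>Let \<open>r = nrm x d\<close>. The mixed bound and \<open>nrm_along_le\<close> show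
  that \<open>\<psi> s = H (x + s *\<^sub>R d) v v\<close> has logarithmic growth rate at most
  \<open>2 * r / (1 - s * r)\<close> in absolute value. Hence
  \<open>\<psi> s * (1 - s * r)\<^sup>2\<close> is nonincreasing and
  \<open>\<psi> s / (1 - s * r)\<^sup>2\<close> is nondecreasing.\<close>

lemma H_along_bounds:
  fixes t :: real
  assumes x: "x \<in> S" and xt: "x + t *\<^sub>R d \<in> S" and t: "0 \<le> t" and r: "t * nrm x d < 1"
  shows "H (x + t *\<^sub>R d) v v \<le> H x v v / (1 - t * nrm x d)\<^sup>2"
    and "(1 - t * nrm x d)\<^sup>2 * H x v v \<le> H (x + t *\<^sub>R d) v v"
proof -
  define \<psi> where "\<psi> s = H (x + s *\<^sub>R d) v v" for s
  define r where "r = nrm x d"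
  have r0: "0 \<le> r" using nrm_nonneg[OF x] by (simp add: r_def)
  have *: "0 < 1 - s * r \<and> \<bar>K (x + s *\<^sub>R d) v v d\<bar> * (1 - s * r) \<le> 2 * r * \<psi> s
      \<and> (\<psi> has_real_derivative K (x + s *\<^sub>R d) v v d) (at s)"
    if s: "0 \<le> s" "s \<le> t" for s
  proof (intro conjI)
    note S = segment_in[OF x xt s]
    have "s * r \<le> t * r" using s r0 by (simp add: mult_right_mono)
    then show p: "0 < 1 - s * r" using r by (simp add: r_def)
    have "K (x + s *\<^sub>R d) v v d = K (x + s *\<^sub>R d) d v v"
      using K_commute12[OF S] K_commute23[OF S] by metis
    then have "\<bar>K (x + s *\<^sub>R d) v v d\<bar> \<le> 2 * nrm (x + s *\<^sub>R d) d * \<psi> s"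
      using third_mixed_le[OF S] by (simp add: \<psi>_def)
    also have "\<dots> \<le> 2 * (r / (1 - s * r)) * \<psi> s"
      using nrm_along_le[OF x S s(1)] p H_nonneg[OF S]
      by (intro mult_right_mono mult_left_mono) (auto simp: r_def \<psi>_def)
    finally show "\<bar>K (x + s *\<^sub>R d) v v d\<bar> * (1 - s * r) \<le> 2 * r * \<psi> s"
      using p by (simp add: field_simps)
    show "(\<psi> has_real_derivative K (x + s *\<^sub>R d) v v d) (at s)"
      unfolding \<psi>_def by (rule H_line[OF S])
  qed
  have "\<psi> t * (1 - t * r)\<^sup>2 \<le> \<psi> 0 * (1 - 0 * r)\<^sup>2"
  proof (rule DERIV_nonpos_imp_nonincreasing[OF t])
    fix s assume "0 \<le> s" "s \<le> t"
    let ?k = "K (x + s *\<^sub>R d) v v d"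
    from *[OF \<open>0 \<le> s\<close> \<open>s \<le> t\<close>] have p: "0 < 1 - s * r"
      and k: "\<bar>?k\<bar> * (1 - s * r) \<le> 2 * r * \<psi> s"
      and D: "(\<psi> has_real_derivative ?k) (at s)" by auto
    have "((\<lambda>s. \<psi> s * (1 - s * r)\<^sup>2) has_real_derivative
        (1 - s * r) * (?k * (1 - s * r) - 2 * r * \<psi> s)) (at s)"
      by (auto intro!: derivative_eq_intros D simp: power2_eq_square algebra_simps)
    moreover have "?k * (1 - s * r) \<le> \<bar>?k\<bar> * (1 - s * r)"
      using p by (intro mult_right_mono) auto
    then have "?k * (1 - s * r) - 2 * r * \<psi> s \<le> 0" using k by linarith
    then have "(1 - s * r) * (?k * (1 - s * r) - 2 * r * \<psi> s) \<le> 0"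
      using p by (intro mult_nonneg_nonpos) auto
    ultimately show "\<exists>y. ((\<lambda>s. \<psi> s * (1 - s * r)\<^sup>2) has_real_derivative y) (at s) \<and> y \<le> 0"
      by blast
  qed
  then show "H (x + t *\<^sub>R d) v v \<le> H x v v / (1 - t * nrm x d)\<^sup>2"
    using *[OF t order_refl] by (simp add: \<psi>_def r_def[symmetric] field_simps)
  have "\<psi> 0 / (1 - 0 * r)\<^sup>2 \<le> \<psi> t / (1 - t * r)\<^sup>2"
  proof (rule DERIV_nonneg_imp_nondecreasing[OF t])
    fix s assume "0 \<le> s" "s \<le> t"
    let ?k = "K (x + s *\<^sub>R d) v v d"
    from *[OF \<open>0 \<le> s\<close> \<open>s \<le> t\<close>] have p: "0 < 1 - s * r"
      and k: "\<bar>?k\<bar> * (1 - s * r) \<le> 2 * r * \<psi> s"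
      and D: "(\<psi> has_real_derivative ?k) (at s)" by auto
    have "((\<lambda>s. \<psi> s * (1 / (1 - s * r)\<^sup>2)) has_real_derivative
        ?k * (1 / (1 - s * r)\<^sup>2) + 2 * r / (1 - s * r) ^ 3 * \<psi> s) (at s)"
      using p by (intro DERIV_mult D deriv_inverse_square) simp
    moreover have "?k * (1 / (1 - s * r)\<^sup>2) + 2 * r / (1 - s * r) ^ 3 * \<psi> s
        = (?k * (1 - s * r) + 2 * r * \<psi> s) / (1 - s * r) ^ 3"
      using p by (simp add: add_divide_distrib power_numeral_reduce)
    ultimately have "((\<lambda>s. \<psi> s / (1 - s * r)\<^sup>2) has_real_derivative
        (?k * (1 - s * r) + 2 * r * \<psi> s) / (1 - s * r) ^ 3) (at s)" by simp
    moreover have "- ?k * (1 - s * r) \<le> \<bar>?k\<bar> * (1 - s * r)"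
      using p by (intro mult_right_mono) auto
    then have "0 \<le> ?k * (1 - s * r) + 2 * r * \<psi> s" using k by linarith
    then have "0 \<le> (?k * (1 - s * r) + 2 * r * \<psi> s) / (1 - s * r) ^ 3"
      using p by (intro divide_nonneg_pos) auto
    ultimately show "\<exists>y. ((\<lambda>s. \<psi> s / (1 - s * r)\<^sup>2) has_real_derivative y) (at s) \<and> 0 \<le> y"
      by blast
  qed
  then show "(1 - t * nrm x d)\<^sup>2 * H x v v \<le> H (x + t *\<^sub>R d) v v"
    using *[OF t order_refl] by (simp add: \<psi>_def r_def[symmetric] field_simps)
qed

lemma nrm_along_bounds:
  fixes t :: real
  assumes x: "x \<in> S" and xt: "x + t *\<^sub>R d \<in> S" and t: "0 \<le> t" and r: "t * nrm x d < 1"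
  shows "nrm (x + t *\<^sub>R d) v \<le> nrm x v / (1 - t * nrm x d)"
    and "(1 - t * nrm x d) * nrm x v \<le> nrm (x + t *\<^sub>R d) v"
  using real_sqrt_le_mono[OF H_along_bounds(1)[OF assms, of v]]
    real_sqrt_le_mono[OF H_along_bounds(2)[OF assms, of v]] r
  by (simp_all add: nrm_def real_sqrt_divide real_sqrt_mult)

text \<open>The mixed bound on \<open>K\<close> is integrated twice along the segment. Since
  \<open>w\<close> is arbitrary, this bounds the dual local norm of the linearisation error;
  \<open>- w\<close> gives the other sign.\<close>

lemma gradient_error_upper:
  assumes x: "x \<in> S" and xd: "x + d \<in> S" and r: "nrm x d < 1"
  shows "dird g w (x + d) - dird g w x - H x w d \<le> nrm x w * ((nrm x d)\<^sup>2 / (1 - nrm x d))"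
proof -
  define r where "r = nrm x d"
  define N where "N = nrm x w"
  have r0: "0 \<le> r" "r < 1" and N0: "0 \<le> N"
    using nrm_nonneg[OF x] assms(3) by (simp_all add: r_def N_def)
  have in_S: "x + s *\<^sub>R d \<in> S" if "0 \<le> s" "s \<le> 1" for s
    using segment_in[of x 1 d s] x xd that by simp
  have p: "0 < 1 - s * r" if "0 \<le> s" "s \<le> 1" for s
    using that r0 mult_left_le_one_le[of r s] by linarith
  \<comment> \<open>First integration: the third derivative is at most
    \<open>2 * N * r\<^sup>2 / (1 - s * r) ^ 3\<close>, the derivative of the subtracted
    term.\<close>
  have E: "H (x + t *\<^sub>R d) w d - H x w d \<le> N * r * (1 / (1 - t * r)\<^sup>2 - 1)"
    if t: "0 \<le> t" "t \<le> 1" for t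
  proof -
    let ?G = "\<lambda>s. H (x + s *\<^sub>R d) w d - N * r * (1 / (1 - s * r)\<^sup>2 - 1)"
    have "?G t \<le> ?G 0"
    proof (rule DERIV_nonpos_imp_nonincreasing[OF t(1)])
      fix s assume "0 \<le> s" "s \<le> t"
      then have s: "0 \<le> s" "s \<le> 1" using t by auto
      note S = in_S[OF s] and q = p[OF s]
      let ?k = "K (x + s *\<^sub>R d) w d d"
      have "1 - s * r \<noteq> 0" using q by simp
      then have D: "(?G has_real_derivative ?k - N * r * (2 * r / (1 - s * r) ^ 3)) (at s)"
        using DERIV_diff[OF H_line[OF S] DERIV_cmult[OF DERIV_diff[OF deriv_inverse_square DERIV_const]]]
        by simp
      have sr: "s * nrm x d < 1" using q by (simp add: r_def)
      have "?k \<le> 2 * nrm (x + s *\<^sub>R d) w * H (x + s *\<^sub>R d) d d"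
        using third_mixed_le[OF S, of w d] by linarith
      also have "\<dots> \<le> 2 * (N / (1 - s * r)) * (r\<^sup>2 / (1 - s * r)\<^sup>2)"
        using nrm_along_bounds(1)[OF x S s(1) sr, of w] H_along_bounds(1)[OF x S s(1) sr, of d]
          H_nonneg[OF S] nrm_nonneg[OF S] N0 q
        by (intro mult_mono) (auto simp: N_def r_def nrm_squared[OF x])
      also have "\<dots> = N * r * (2 * r / (1 - s * r) ^ 3)"
        by (simp add: power_numeral_reduce)
      finally show "\<exists>y. (?G has_real_derivative y) (at s) \<and> y \<le> 0"
        using D by (intro exI[of _ "?k - N * r * (2 * r / (1 - s * r) ^ 3)"]) auto
    qed
    then show ?thesis by simp
  qed
  \<comment> \<open>Second integration: \<open>s / (1 - s * r)\<close> is the antiderivative of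
    \<open>1 / (1 - s * r)\<^sup>2\<close> that vanishes at 0.\<close>
  let ?F = "\<lambda>s. dird g w (x + s *\<^sub>R d) - s * H x w d - N * r * (s / (1 - s * r) - s)"
  have "?F 1 \<le> ?F 0"
  proof (rule DERIV_nonpos_imp_nonincreasing[of 0 1 ?F])
    show "(0::real) \<le> 1" by simp
    fix s :: real assume s: "0 \<le> s" "s \<le> 1"
    note S = in_S[OF s] and q = p[OF s]
    have "((\<lambda>s. dird g w (x + s *\<^sub>R d)) has_real_derivative H (x + s *\<^sub>R d) w d) (at s)"
      unfolding H_def by (intro dird_line diff2 S)
    then have D: "(?F has_real_derivative
        H (x + s *\<^sub>R d) w d - H x w d - N * r * (1 / (1 - s * r)\<^sup>2 - 1)) (at s)"
      using q by (auto intro!: derivative_eq_intros simp: power2_eq_square field_simps)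
    then show "\<exists>y. (?F has_real_derivative y) (at s) \<and> y \<le> 0"
      using E[OF s] by (intro exI[of _ "H (x + s *\<^sub>R d) w d - H x w d - N * r * (1 / (1 - s * r)\<^sup>2 - 1)"]) auto
  qed
  then have "dird g w (x + d) - dird g w x - H x w d \<le> N * r * (1 / (1 - r) - 1)" by simp
  also have "\<dots> = N * (r\<^sup>2 / (1 - r))"
    using r0 by (simp add: field_simps power2_eq_square)
  finally show ?thesis by (simp add: N_def r_def)
qed

text \<open>On the part of the segment in \<open>S\<close> the second derivative is at most a
  constant, so slope and value are bounded too. The absolute value makes the bound independent of
  \<open>t\<close>, as the closedness argument of \<open>dikin_ellipsoid_subset\<close>
  requires.\<close>

lemma value_along_le:
  fixes t :: real
  assumes x: "x \<in> S" and xt: "x + t *\<^sub>R d \<in> S" and t: "0 \<le> t" "t \<le> 1" and r: "nrm x d < 1"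
  shows "g (x + t *\<^sub>R d) \<le> g x + \<bar>dird g d x\<bar> + (nrm x d)\<^sup>2 / (1 - nrm x d)\<^sup>2"
proof -
  define L where "L = (nrm x d)\<^sup>2 / (1 - nrm x d)\<^sup>2"
  have L0: "0 \<le> L" by (simp add: L_def)
  have slope: "dird g d (x + s *\<^sub>R d) \<le> \<bar>dird g d x\<bar> + L" if s: "0 \<le> s" "s \<le> t" for s
  proof -
    let ?f = "\<lambda>a. dird g d (x + a *\<^sub>R d) - L * a"
    have "?f s \<le> ?f 0"
    proof (rule DERIV_nonpos_imp_nonincreasing[OF s(1)])
      fix a assume a: "0 \<le> a" "a \<le> s"
      note S = segment_in[OF x xt a(1) order_trans[OF a(2) s(2)]]
      have a1: "a * nrm x d \<le> nrm x d"
        using a s t nrm_nonneg[OF x] by (intro mult_left_le_one_le) auto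
      then have "H (x + a *\<^sub>R d) d d \<le> H x d d / (1 - a * nrm x d)\<^sup>2"
        using r by (intro H_along_bounds x S a) linarith
      also have "\<dots> \<le> L"
        unfolding L_def nrm_squared[OF x] using a1 r H_nonneg[OF x]
        by (intro divide_left_mono power_mono mult_pos_pos zero_less_power) auto
      finally have "H (x + a *\<^sub>R d) d d - L \<le> 0" by simp
      moreover have "((\<lambda>a. dird g d (x + a *\<^sub>R d)) has_real_derivative H (x + a *\<^sub>R d) d d) (at a)"
        unfolding H_def by (intro dird_line diff2 S)
      then have "(?f has_real_derivative H (x + a *\<^sub>R d) d d - L) (at a)"
        by (auto intro!: derivative_eq_intros)
      ultimately show "\<exists>y. (?f has_real_derivative y) (at a) \<and> y \<le> 0" by blast
    qed
    moreover have "L * s \<le> L" using s t L0 by (intro mult_left_le) auto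
    ultimately show ?thesis by simp
  qed
  let ?f = "\<lambda>a. g (x + a *\<^sub>R d) - (\<bar>dird g d x\<bar> + L) * a"
  have "?f t \<le> ?f 0"
  proof (rule DERIV_nonpos_imp_nonincreasing[OF t(1)])
    fix a assume a: "0 \<le> a" "a \<le> t"
    have "((\<lambda>a. g (x + a *\<^sub>R d)) has_real_derivative dird g d (x + a *\<^sub>R d)) (at a)"
      by (intro dird_line diff1 segment_in[OF x xt a])
    then have "(?f has_real_derivative dird g d (x + a *\<^sub>R d) - (\<bar>dird g d x\<bar> + L)) (at a)"
      by (auto intro!: derivative_eq_intros)
    then show "\<exists>y. (?f has_real_derivative y) (at a) \<and> y \<le> 0"
      using slope[OF a] by (intro exI[of _ "dird g d (x + a *\<^sub>R d) - (\<bar>dird g d x\<bar> + L)"]) auto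
  qed
  moreover have "(\<bar>dird g d x\<bar> + L) * t \<le> \<bar>dird g d x\<bar> + L"
    using t L0 by (intro mult_left_le) auto
  ultimately show ?thesis by (simp add: L_def)
qed

section \<open>One inexact Newton step\<close>

text \<open>The target \<open>z\<close> enters only through local norms and derivatives at
  \<open>xs\<close> and \<open>x\<close>, so the first bound can be used afterwards to place
  \<open>z\<close> in the domain.\<close>

lemma newton_step:
  assumes xs: "xs \<in> S" and x: "x \<in> S" and L: "nrm xs (x - xs) \<le> L" "L < 1/2" and e: "0 \<le> e"
    and opt: "0 \<le> dird g (z - xs) xs"
    and inexact: "dird g (z - xs) x + H x (z - x) (z - xs) \<le> e\<^sup>2"
  shows "nrm xs (z - xs) \<le> e / (1 - L) + L\<^sup>2 / ((1 - 2 * L) * (1 - L)\<^sup>2)"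
    and "nrm x (z - x) \<le> e + L / (1 - 2 * L)"
proof -
  define w where "w = z - xs"
  define N where "N = nrm x w"
  define r where "r = nrm x (xs - x)"
  define l where "l = nrm xs (x - xs)"
  \<comment> \<open>This is \<open>r\<^sup>2 / (1 - r)\<close> evaluated at
    \<open>r = L / (1 - L)\<close>; the condition \<open>L < 1/2\<close> keeps that argument below
    1.\<close>
  define \<rho> where "\<rho> = L\<^sup>2 / ((1 - L) * (1 - 2 * L))"
  have l: "0 \<le> l" "l \<le> L" using L nrm_nonneg[OF xs] by (auto simp: l_def)
  have N0: "0 \<le> N" using nrm_nonneg[OF x] by (simp add: N_def)
  have x': "xs + 1 *\<^sub>R (x - xs) \<in> S" using x by simp
  have l1: "1 * nrm xs (x - xs) < 1" using L by simp
  have "r = nrm x (x - xs)" using nrm_minus[OF x, of "x - xs"] by (simp add: r_def)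
  also have "\<dots> \<le> l / (1 - l)"
    using nrm_along_bounds(1)[OF xs x' _ l1, of "x - xs"] by (simp add: l_def)
  also have "\<dots> \<le> L / (1 - L)" using l L by (intro frac_le) auto
  finally have r: "r \<le> L / (1 - L)" .
  have "L / (1 - L) < 1" using L by (simp add: pos_divide_less_eq)
  with r have r1: "r < 1" by simp
  have r0: "0 \<le> r" using nrm_nonneg[OF x] by (simp add: r_def)
  have "r\<^sup>2 / (1 - r) \<le> (L / (1 - L))\<^sup>2 / (1 - L / (1 - L))"
    using r r0 r1 \<open>L / (1 - L) < 1\<close> by (intro frac_le power_mono) auto
  also have "\<dots> = \<rho>"
  proof -
    have "1 - L / (1 - L) = (1 - 2 * L) / (1 - L)" using L by (simp add: field_simps)
    then show ?thesis using L by (simp add: \<rho>_def power2_eq_square)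
  qed
  finally have \<rho>: "r\<^sup>2 / (1 - r) \<le> \<rho>" .
  have "dird g w xs - dird g w x - H x w (xs - x) \<le> N * (r\<^sup>2 / (1 - r))"
    using gradient_error_upper[OF x, of "xs - x" w] xs r1 by (simp add: N_def r_def)
  also have "\<dots> \<le> N * \<rho>" using \<rho> N0 by (rule mult_left_mono)
  finally have err: "- dird g w x - H x w (xs - x) \<le> N * \<rho>" using opt by (simp add: w_def)
  have "N\<^sup>2 = H x w w" by (simp add: N_def nrm_squared[OF x])
  also have "H x w w = H x w (z - x) - H x w (xs - x)"
    using linear_diff[OF linear_H[OF x], of w "z - x" "xs - x"] by (simp add: w_def)
  also have "H x w (z - x) = H x (z - x) w" using H_commute[OF x] .
  finally have N2: "N * N \<le> e * e + N * \<rho>"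
    using err inexact unfolding w_def[symmetric] by (simp add: power2_eq_square)
  have "0 \<le> \<rho>" using L l by (auto simp: \<rho>_def intro!: divide_nonneg_pos)
  \<comment> \<open>If \<open>N > e + \<rho>\<close>, then
    \<open>N * (N - \<rho>) > N * e \<ge> e * e\<close>, against \<open>N2\<close>.\<close>
  have N: "N \<le> e + \<rho>"
  proof (rule ccontr)
    assume "\<not> N \<le> e + \<rho>"
    then have "0 < N" "e \<le> N" "e < N - \<rho>" using e \<open>0 \<le> \<rho>\<close> by auto
    then have "e * e \<le> N * e" "N * e < N * (N - \<rho>)" using e by (auto intro: mult_right_mono)
    then show False using N2 by (simp add: algebra_simps)
  qed
  have "(1 - L) * nrm xs w \<le> (1 - l) * nrm xs w"
    using l nrm_nonneg[OF xs] by (intro mult_right_mono) auto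
  also have "\<dots> \<le> N"
    using nrm_along_bounds(2)[OF xs x' _ l1, of w] by (simp add: l_def N_def)
  finally have "nrm xs w \<le> (e + \<rho>) / (1 - L)"
    using N L by (simp add: pos_le_divide_eq mult.commute)
  also have "\<dots> = e / (1 - L) + L\<^sup>2 / ((1 - 2 * L) * (1 - L)\<^sup>2)"
    by (simp add: add_divide_distrib \<rho>_def power2_eq_square mult.commute mult.left_commute)
  finally show "nrm xs (z - xs) \<le> e / (1 - L) + L\<^sup>2 / ((1 - 2 * L) * (1 - L)\<^sup>2)"
    by (simp add: w_def)
  \<comment> \<open>Split \<open>z - x\<close> at \<open>xs\<close> as
    \<open>w + (xs - x)\<close>.\<close>
  have "nrm x (z - x) \<le> N + r"
    using nrm_triangle[OF x, of w "xs - x"] by (simp add: w_def N_def r_def)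
  also have "\<dots> \<le> e + (\<rho> + L / (1 - L))" using N r by simp
  also have "\<rho> + L / (1 - L) = L / (1 - 2 * L)"
    using L by (simp add: \<rho>_def divide_simps) (simp add: power2_eq_square algebra_simps)
  finally show "nrm x (z - x) \<le> e + L / (1 - 2 * L)" .
qed

end

subsection \<open>Extended-valued functions and the full-step scheme\<close>

text \<open>Agreement of \<open>\<phi>\<close> with \<open>h\<close> is asked only at parameters
  whose point lies in \<open>S\<close>. This lets the lemma be applied in turn to the successive
  derivatives of a restriction to a line.\<close>

lemma dird_deriv_line:
  assumes "open S" "\<And>y. y \<in> S \<Longrightarrow> h differentiable (at y)"
    and "\<And>t. x + t *\<^sub>R v \<in> S \<Longrightarrow> \<phi> t = h (x + t *\<^sub>R v)" and t: "x + t *\<^sub>R v \<in> S"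
  shows "deriv \<phi> t = dird h v (x + t *\<^sub>R v)"
proof -
  have "open ((\<lambda>t. x + t *\<^sub>R v) -` S)"
    using assms(1) by (intro open_vimage continuous_intros)
  then have "(\<phi> has_real_derivative dird h v (x + t *\<^sub>R v)) (at t)"
    using assms(2,3) t
    by (intro has_field_derivative_transform_within_open[OF dird_line]) auto
  then show ?thesis by (rule DERIV_imp_deriv)
qed

lemma partial_eq_dird: "partial i h = dird h (axis i 1)"
  by (auto simp: partial_def dird_def)

lemma linear_sum_axis:
  fixes L :: "real ^ 'n \<Rightarrow> real"
  assumes "linear L"
  shows "L w = (\<Sum>i\<in>UNIV. w $ i * L (axis i 1))"
proof -
  have "L w = L (\<Sum>i\<in>UNIV. (w $ i) *\<^sub>R axis i 1)"
    using basis_expansion[of w] by (simp add: scalar_mult_eq_scaleR)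
  also have "\<dots> = (\<Sum>i\<in>UNIV. w $ i * L (axis i 1))"
    by (simp add: linear_sum[OF assms] linear_cmul[OF assms])
  finally show ?thesis .
qed

lemma grad_inner:
  assumes "finval f differentiable (at x)"
  shows "grad f x \<bullet> w = dird (finval f) w x"
  using linear_sum_axis[OF linear_dird[OF assms], of w]
  by (simp add: inner_vec_def grad_def partial_eq_dird mult.commute)

text \<open>Expand both slots in the standard basis. Entry \<open>(i, j)\<close> of
  \<open>hess\<close> differentiates first along \<open>j\<close> and then along \<open>i\<close>,
  so rows pair with \<open>v\<close> and columns with \<open>u\<close>.\<close>

lemma hess_inner:
  assumes "c3_function (edom f) (finval f)" and x: "x \<in> edom f"
  shows "v \<bullet> (hess f x *v u) = c3_function.H (finval f) x u v"
proof -
  interpret c3_function "edom f" "finval f" by fact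
  have "H x u v = (\<Sum>i\<in>UNIV. v $ i * (\<Sum>j\<in>UNIV. u $ j * H x (axis j 1) (axis i 1)))"
    unfolding linear_sum_axis[OF linear_H[OF x], of u v]
    by (intro sum.cong refl arg_cong2[where f = "(*)"] linear_sum_axis[OF linear_H_left[OF x]])
  then show ?thesis
    by (simp add: inner_vec_def matrix_vector_mult_def hess_def partial_eq_dird H_def mult.commute)
qed

lemma ereal_finval:
  assumes "proper_closed_convex f" "x \<in> edom f"
  shows "ereal (finval f x) = f x"
  using assms by (cases "f x") (auto simp: proper_closed_convex_def edom_def finval_def)

text \<open>The domain is the projection of the convex epigraph.\<close>

lemma convex_edom:
  assumes "proper_closed_convex f"
  shows "convex (edom f)"
proof -
  have "edom f = fst ` epi f"
  proof (intro equalityI subsetI)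
    fix x assume "x \<in> edom f"
    then have "(x, finval f x) \<in> epi f" using ereal_finval[OF assms] by (simp add: epi_def)
    then show "x \<in> fst ` epi f" by force
  qed (auto simp: edom_def epi_def intro: order.strict_trans1)
  then show ?thesis
    using assms by (auto simp: proper_closed_convex_def intro: convex_linear_image linear_fst)
qed

lemma convex_on_finval:
  assumes f: "proper_closed_convex f"
  shows "convex_on (edom f) (finval f)"
proof (rule convex_onI[OF _ convex_edom[OF f]])
  fix t :: real and x y assume *: "0 < t" "t < 1" "x \<in> edom f" "y \<in> edom f"
  have "(x, finval f x) \<in> epi f" "(y, finval f y) \<in> epi f"
    using ereal_finval[OF f] * by (auto simp: epi_def)
  then have "(1 - t) *\<^sub>R (x, finval f x) + t *\<^sub>R (y, finval f y) \<in> epi f"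
    using * f by (intro convexD) (auto simp: proper_closed_convex_def)
  then have "f ((1 - t) *\<^sub>R x + t *\<^sub>R y) \<le> ereal ((1 - t) * finval f x + t * finval f y)"
    by (simp add: epi_def)
  moreover have "(1 - t) *\<^sub>R x + t *\<^sub>R y \<in> edom f"
    using * convex_edom[OF f] by (intro convexD) auto
  ultimately show "finval f ((1 - t) *\<^sub>R x + t *\<^sub>R y) \<le> (1 - t) * finval f x + t * finval f y"
    using ereal_finval[OF f] by (metis ereal_less_eq(3))
qed

lemma c3_function_finval:
  assumes "standard_self_concordant f"
  shows "c3_function (edom f) (finval f)"
proof -
  have "dird h v = (\<lambda>x. frechet_derivative h (at x) v)" for h :: "real ^ 'a \<Rightarrow> real" and v
    by (auto simp: dird_def)
  then show ?thesis
    using assms unfolding standard_self_concordant_def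
    by (intro c3_function.intro) (auto simp: numeral_3_eq_3)
qed

lemma self_concordant_finval:
  assumes f: "proper_closed_convex f" and sc: "standard_self_concordant f"
    and inv: "\<And>y. y \<in> edom f \<Longrightarrow> invertible (hess f y)"
  shows "self_concordant (edom f) (finval f)"
proof -
  have c3: "c3_function (edom f) (finval f)" using sc by (rule c3_function_finval)
  then interpret c3_function "edom f" "finval f" .
  show ?thesis
  proof
    show "convex_on (edom f) (finval f)" using f by (rule convex_on_finval)
    fix x v assume x: "x \<in> edom f"
    show "\<exists>w. H x v w \<noteq> 0" if "v \<noteq> 0"
    proof (intro exI notI)
      \<comment> \<open>The witness is the image of \<open>v\<close> under the Hessian: the pairing
        is then the squared Euclidean norm of that image.\<close>
      assume "H x v (hess f x *v v) = 0"
      then have "hess f x *v v = 0" using hess_inner[OF c3 x, of "hess f x *v v" v] by simp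
      moreover have "inj ((*v) (hess f x))" using inv[OF x] by (rule inj_matrix_vector_mult)
      ultimately have "v = 0" by (metis injD matrix_vector_mult_0_right)
      with that show False by simp
    qed
    define \<phi> where "\<phi> = (\<lambda>t. finval f (x + t *\<^sub>R v))"
    have d1: "deriv \<phi> t = dird (finval f) v (x + t *\<^sub>R v)" if "x + t *\<^sub>R v \<in> edom f" for t
      using that by (intro dird_deriv_line[OF open_S diff1]) (auto simp: \<phi>_def)
    have d2: "deriv (deriv \<phi>) t = H (x + t *\<^sub>R v) v v" if "x + t *\<^sub>R v \<in> edom f" for t
      using that d1 unfolding H_def by (intro dird_deriv_line[OF open_S diff2]) auto
    have d3: "deriv (deriv (deriv \<phi>)) t = K (x + t *\<^sub>R v) v v v" if "x + t *\<^sub>R v \<in> edom f" for t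
      using that d2 unfolding K_def H_def by (intro dird_deriv_line[OF open_S diff3]) auto
    \<comment> \<open>The line inequality is taken at parameter 0, where the derivatives of
      \<open>\<phi>\<close> are those at \<open>x\<close> itself.\<close>
    have "x + 0 *\<^sub>R v \<in> edom f" using x by simp
    then have "\<bar>(deriv ^^ 3) \<phi> 0\<bar> \<le> 2 * ((deriv ^^ 2) \<phi> 0) powr (3/2)"
      using sc x unfolding standard_self_concordant_def Let_def \<phi>_def by blast
    then show "\<bar>K x v v v\<bar> \<le> 2 * H x v v powr (3/2)"
      using d2[of 0] d3[of 0] x by (simp add: numeral_3_eq_3 numeral_2_eq_2)
  qed
qed

lemma dikin_ellipsoid_subset:
  assumes f: "proper_closed_convex f" and "self_concordant (edom f) (finval f)"
    and x: "x \<in> edom f" and d: "c3_function.nrm (finval f) x d < 1"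
  shows "x + d \<in> edom f"
proof -
  interpret self_concordant "edom f" "finval f" by fact
  define M where "M = finval f x + \<bar>dird (finval f) d x\<bar> + (nrm x d)\<^sup>2 / (1 - nrm x d)\<^sup>2"
  define A where "A = {0..1} \<inter> (\<lambda>t::real. x + t *\<^sub>R d) -` edom f"
  \<comment> \<open>\<open>f\<close> is bounded by \<open>M\<close> on the part of the segment inside the domain, so that this part is
    closed because the epigraph is; it is also open.\<close>
  have eq: "A = {0..1} \<inter> (\<lambda>t. (x + t *\<^sub>R d, M)) -` epi f"
  proof (intro equalityI subsetI)
    fix t assume t: "t \<in> A"
    then have "finval f (x + t *\<^sub>R d) \<le> M"
      unfolding M_def by (intro value_along_le x d) (auto simp: A_def)
    then have "f (x + t *\<^sub>R d) \<le> ereal M"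
      using t ereal_finval[OF f, of "x + t *\<^sub>R d"] by (simp add: A_def flip: ereal_less_eq(3))
    then show "t \<in> {0..1} \<inter> (\<lambda>t. (x + t *\<^sub>R d, M)) -` epi f"
      using t by (simp add: A_def epi_def)
  qed (auto simp: A_def edom_def epi_def intro: order.strict_trans1)
  have "closed A"
    unfolding eq using f
    by (intro closed_Int closed_vimage continuous_intros) (auto simp: proper_closed_convex_def)
  then have "closedin (top_of_set {0..1}) A"
    by (rule closed_subset[rotated]) (auto simp: A_def)
  moreover have "open ((\<lambda>t::real. x + t *\<^sub>R d) -` edom f)"
    using open_S by (intro open_vimage continuous_intros)
  then have "openin (top_of_set {0..1}) A"
    unfolding A_def by (rule openin_open_Int)
  moreover have "0 \<in> A" using x by (simp add: A_def)
  ultimately have "A = {0..1}"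
    using connected_clopen[of "{0..1::real}"] by auto
  then have "1 \<in> A" by simp
  then show ?thesis by (simp add: A_def)
qed

section \<open>Optimality condition and output of the subroutine\<close>

text \<open>A negative slope towards \<open>z\<close> would decrease the value for a short step,
  which stays in \<open>X\<close> by convexity and in the domain by openness.\<close>

lemma arg_min_dird_nonneg:
  assumes f: "proper_closed_convex f" and op: "open (edom f)" and "convex X"
    and diff: "finval f differentiable (at xstar)"
    and min: "is_arg_min f (\<lambda>y. y \<in> X) xstar" and xstar: "xstar \<in> edom f" and z: "z \<in> X"
  shows "0 \<le> dird (finval f) (z - xstar) xstar"
proof (rule ccontr)
  let ?\<phi> = "\<lambda>s. finval f (xstar + s *\<^sub>R (z - xstar))"
  assume "\<not> 0 \<le> dird (finval f) (z - xstar) xstar"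
  then have neg: "dird (finval f) (z - xstar) xstar < 0" by simp
  have "(?\<phi> has_real_derivative dird (finval f) (z - xstar) xstar) (at 0)"
    using dird_line[of "finval f" xstar 0 "z - xstar"] diff by simp
  from DERIV_neg_dec_right[OF this neg] obtain a where a: "0 < a"
    "\<And>h. 0 < h \<Longrightarrow> h < a \<Longrightarrow> ?\<phi> h < finval f xstar"
    by auto
  have "open ((\<lambda>t::real. xstar + t *\<^sub>R (z - xstar)) -` edom f)"
    using op by (intro open_vimage continuous_intros)
  moreover have "0 \<in> (\<lambda>t::real. xstar + t *\<^sub>R (z - xstar)) -` edom f"
    using xstar by simp
  ultimately obtain b where b: "0 < b"
    "ball 0 b \<subseteq> (\<lambda>t::real. xstar + t *\<^sub>R (z - xstar)) -` edom f"
    using open_contains_ball by blast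
  define h where "h = min 1 (min a b) / 2"
  have h: "0 < h" "h < a" "h < b" "h < 1" using a(1) b(1) by (auto simp: h_def)
  let ?y = "xstar + h *\<^sub>R (z - xstar)"
  have "(1 - h) *\<^sub>R xstar + h *\<^sub>R z \<in> X"
    using min z h \<open>convex X\<close> by (intro convexD) (auto simp: is_arg_min_def)
  moreover have "(1 - h) *\<^sub>R xstar + h *\<^sub>R z = ?y" by (simp add: algebra_simps)
  ultimately have "f xstar \<le> f ?y" using min by (auto simp: is_arg_min_linorder)
  moreover have "?y \<in> edom f" using b h by (auto simp: subset_iff)
  ultimately have "finval f xstar \<le> finval f ?y"
    using ereal_finval[OF f] xstar by (metis ereal_less_eq(3))
  then show False using a(2)[OF h(1,2)] by simp
qed

text \<open>Each update is a convex combination of points of \<open>X\<close>, and at the last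
  iterate the maximiser tested by the stopping rule dominates every \<open>y\<close> in
  \<open>X\<close>.\<close>

lemma fw_returns_approx_min:
  assumes "convex X" "u0 \<in> X" and psd: "\<And>w. 0 \<le> w \<bullet> (H *v w)" and "0 \<le> e"
    and "fw_returns X q H u0 e z"
  shows "z \<in> X" and "\<And>y. y \<in> X \<Longrightarrow> fw_grad q H u0 z \<bullet> (z - y) \<le> e"
proof -
  obtain u v T where u0: "u 0 = u0"
    and v: "\<And>t. t \<le> T \<Longrightarrow>
      is_arg_max (\<lambda>s. fw_grad q H u0 (u t) \<bullet> (u t - s)) (\<lambda>s. s \<in> X) (v t)"
    and step: "\<And>t. t < T \<Longrightarrow> fw_gap q H u0 (u t) (v t) > e \<and>
      u (Suc t) = fw_update q H u0 (u t) (v t)"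
    and stop: "fw_gap q H u0 (u T) (v T) \<le> e" and z: "z = u T"
    using assms(5) unfolding fw_returns_def by blast
  have "t \<le> T \<Longrightarrow> u t \<in> X" for t
  proof (induction t)
    case 0
    then show ?case using u0 assms by simp
  next
    case (Suc t)
    define \<tau> where
      "\<tau> = min 1 (fw_gap q H u0 (u t) (v t) / ((v t - u t) \<bullet> (H *v (v t - u t))))"
    have "0 < fw_gap q H u0 (u t) (v t)" using step[of t] Suc.prems \<open>0 \<le> e\<close> by auto
    \<comment> \<open>If the denominator is 0, the quotient is 0 by convention, so
      \<open>\<tau> = 0\<close> and the bounds still hold.\<close>
    then have \<tau>: "0 \<le> \<tau>" "\<tau> \<le> 1" using psd by (auto simp: \<tau>_def)
    have "u (Suc t) = (1 - \<tau>) *\<^sub>R u t + \<tau> *\<^sub>R v t"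
      using step[of t] Suc.prems by (simp add: fw_update_def \<tau>_def Let_def)
    moreover have "v t \<in> X" using v[of t] Suc.prems by (simp add: is_arg_max_def)
    ultimately show ?case using Suc \<tau> \<open>convex X\<close> by (auto intro: convexD)
  qed
  then show "z \<in> X" using z by simp
  show "fw_grad q H u0 z \<bullet> (z - y) \<le> e" if "y \<in> X" for y
    using v[of T] stop that z by (auto simp: is_arg_max_linorder fw_gap_def intro: order_trans)
qed

section \<open>Linear convergence of the full-step scheme\<close>

theorem theorem4p2:
  fixes f :: "real ^ 'p \<Rightarrow> ereal"
    and X :: "(real ^ 'p) set"
    and xstar :: "real ^ 'p"
    and x :: "nat \<Rightarrow> real ^ 'p"
    and \<eta> :: "nat \<Rightarrow> real"
    and \<sigma> \<beta> C :: real
  assumes "proper_closed_convex f"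
    and "standard_self_concordant f"
    and "\<And>y. y \<in> edom f \<Longrightarrow> invertible (hess f y)"
    and "X \<noteq> {}" and "compact X" and "convex X"
    and "is_arg_min f (\<lambda>y. y \<in> X) xstar"
    and "0 < \<sigma>" and "\<sigma> < 1"
    and "0 < \<beta>" and "\<beta> < 1/2"
    and "C > 1"
    and "1 / (C * (1 - \<beta>)) + \<beta> / ((1 - 2 * \<beta>) * (1 - \<beta>)\<^sup>2) \<le> \<sigma>"
    and "1 / C + 1 / (1 - 2 * \<beta>) \<le> 2"
    and "\<And>k. \<eta> k = \<beta> * \<sigma> ^ k / C"
    and "full_step_scheme f X \<eta> x"
    and "local_norm f xstar (x 0 - xstar) \<le> \<beta>"
  shows "\<forall>k. local_norm f xstar (x k - xstar) \<le> \<beta> * \<sigma> ^ k \<and>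
             local_norm f (x k) (x (Suc k) - x k) \<le> 2 * \<beta> * \<sigma> ^ k"
proof -
  have sc: "self_concordant (edom f) (finval f)"
    using assms(1-3) by (rule self_concordant_finval)
  then interpret self_concordant "edom f" "finval f" .
  note hess = hess_inner[OF c3_function_axioms]
  have nrm: "local_norm f y u = nrm y u" if "y \<in> edom f" for y u
    using hess[OF that] by (simp add: local_norm_def nrm_def)
  have x0: "x 0 \<in> edom f" "x 0 \<in> X"
    and fw: "\<And>k. fw_returns X (grad f (x k)) (hess f (x k)) (x k) ((\<eta> k)\<^sup>2) (x (Suc k))"
    using assms(16) by (auto simp: full_step_scheme_def)
  \<comment> \<open>The starting point has finite value, which forces the minimiser into the
    domain.\<close>
  have "f xstar \<le> f (x 0)" and xsX: "xstar \<in> X"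
    using assms(7) x0 by (auto simp: is_arg_min_linorder)
  then have xs: "xstar \<in> edom f" using x0 by (auto simp: edom_def)
  define L where "L k = \<beta> * \<sigma> ^ k" for k
  have L: "0 < L k" "L k \<le> \<beta>" for k
    using assms(8-10) by (auto simp: L_def power_le_one mult_left_le)
  have e: "\<eta> k = L k / C" for k using assms(15) by (simp add: L_def)
  \<comment> \<open>Domain membership belongs to the invariant, since the local norm at the next
    iterate is used in the following round.\<close>
  have step: "x (Suc k) \<in> edom f \<inter> X \<and> nrm xstar (x (Suc k) - xstar) \<le> L (Suc k) \<and>
      nrm (x k) (x (Suc k) - x k) \<le> 2 * L k"
    if k: "x k \<in> edom f \<inter> X" "nrm xstar (x k - xstar) \<le> L k" for k
  proof -
    let ?z = "x (Suc k)"
    have xk: "x k \<in> edom f" "x k \<in> X" using k by auto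
    note gap = fw_returns_approx_min[OF assms(6) xk(2) _ _ fw[of k]]
    have psd: "0 \<le> w \<bullet> (hess f (x k) *v w)" for w
      using H_nonneg[OF xk(1)] hess[OF xk(1)] by simp
    have zX: "?z \<in> X" using gap(1) psd by simp
    have "fw_grad (grad f (x k)) (hess f (x k)) (x k) ?z \<bullet> (?z - xstar) \<le> (\<eta> k)\<^sup>2"
      using gap(2)[OF psd _ xsX] by simp
    then have inexact: "dird (finval f) (?z - xstar) (x k) + H (x k) (?z - x k) (?z - xstar)
        \<le> (L k / C)\<^sup>2"
      using hess[OF xk(1), of "?z - xstar" "?z - x k"]
        inner_commute[of "hess f (x k) *v (?z - x k)" "?z - xstar"]
      by (simp add: fw_grad_def inner_add_left grad_inner[OF diff1[OF xk(1)]] e)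
    have opt: "0 \<le> dird (finval f) (?z - xstar) xstar"
      using assms(1) open_S assms(6) diff1[OF xs] assms(7) xs zX by (rule arg_min_dird_nonneg)
    have Lk: "L k < 1/2" using L[of k] assms(11) by simp
    have eC: "0 \<le> L k / C" using L[of k] assms(12) by simp
    note bounds = newton_step[OF xs xk(1) k(2) Lk eC opt inexact]
    have "nrm xstar (?z - xstar) \<le>
        L k / C / (1 - L k) + (L k)\<^sup>2 / ((1 - 2 * L k) * (1 - L k)\<^sup>2)"
      by (rule bounds(1))
    \<comment> \<open>Replace \<open>L k\<close> by \<open>\<beta>\<close> in the denominators and
      in one factor of the square. The remaining factor \<open>L k\<close> gives linear contraction
      with rate at most \<open>\<sigma>\<close>.\<close>
    also have "\<dots> \<le> L k / C / (1 - \<beta>) + L k * \<beta> / ((1 - 2 * \<beta>) * (1 - \<beta>)\<^sup>2)"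
      using L[of k] assms(10-12) unfolding power2_eq_square[of "L k"]
      by (intro add_mono frac_le mult_mono power_mono mult_left_mono) auto
    also have "\<dots> = L k * (1 / (C * (1 - \<beta>)) + \<beta> / ((1 - 2 * \<beta>) * (1 - \<beta>)\<^sup>2))"
      by (simp add: distrib_left)
    also have "\<dots> \<le> L k * \<sigma>" using L[of k] assms(13) by (intro mult_left_mono) auto
    finally have 1: "nrm xstar (?z - xstar) \<le> L (Suc k)" by (simp add: L_def mult.assoc mult.commute[of \<sigma>])
    \<comment> \<open>The contraction bound itself puts the new iterate in the Dikin ellipsoid of
      \<open>xstar\<close>.\<close>
    also have "\<dots> < 1" using L(2)[of "Suc k"] assms(11) by simp
    finally have "xstar + (?z - xstar) \<in> edom f"
      by (rule dikin_ellipsoid_subset[OF assms(1) sc xs])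
    moreover have "nrm (x k) (?z - x k) \<le> L k / C + L k / (1 - 2 * L k)" by (rule bounds(2))
    then have "nrm (x k) (?z - x k) \<le> 2 * L k"
    proof (rule order_trans)
      have "L k / C + L k / (1 - 2 * L k) \<le> L k / C + L k / (1 - 2 * \<beta>)"
        using L[of k] assms(11) by (intro add_left_mono frac_le) auto
      also have "\<dots> = L k * (1 / C + 1 / (1 - 2 * \<beta>))" by (simp add: distrib_left)
      also have "\<dots> \<le> L k * 2" using L[of k] assms(14) by (intro mult_left_mono) auto
      finally show "L k / C + L k / (1 - 2 * L k) \<le> 2 * L k" by simp
    qed
    ultimately show ?thesis using 1 zX by simp
  qed
  have inv: "x k \<in> edom f \<inter> X \<and> nrm xstar (x k - xstar) \<le> L k" for k
  proof (induction k)
    case 0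
    then show ?case using x0 assms(17) nrm[OF xs] by (simp add: L_def)
  next
    case (Suc k)
    then show ?case using step[of k] by blast
  qed
  then show ?thesis
    using step nrm xs by (auto simp: L_def mult.assoc)
qed

end
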